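(* (Ganea Sequence) Let $Z$ be a central ideal of a finite-dimensional diassociative algebra $L$. Then the sequence $$(L/L'\otimes Z\oplus Z\otimes L/L')^2\to M(L)\to M(L/Z)\to L'\cap Z\to 0$$ (with the maps described in the context) is exact.
   Context: A diassociative algebra over a field $\mathbb{F}$ is an $\mathbb{F}$-vector space with two associative bilinear products $\dashv,\vdash$ satisfying $x\dashv(y\dashv z)=x\dashv(y\vdash z)$, $(x\vdash y)\dashv z=x\vdash(y\dashv z)$, $(x\dashv y)\vdash z=(x\vdash y)\vdash z$. For subspaces $X,Y$, $X\dashv Y$ and $X\vdash Y$ denote spans of products, and $X\lozenge Y=X\dashv Y+X\vdash Y$. $K'=K\lozenge K$; $Z(K)$ is the set of $z\in K$ with $z\dashv x=x\dashv z=z\vdash x=x\vdash z=0$ for all $x\in K$; a central ideal is an ideal contained in the center. A pair $(K,M)$ is a defining pair for $L$ if $L\cong K/M$ and $M\subseteq Z(K)\cap K'$; if $\dim K$ is maximal among such pairs, $M$ is the multiplier $M(L)$ (zero products, unique up to isomorphism). For any free presentation $0\to R\to F\to L\to0$ of finite-dimensional $L$ ($F$ a free diassociative algebra), $M(L)\cong\frac{F'\cap R}{F\lozenge R+R\lozenge F}$. Maps: choose a free diassociative algebra $F$ and ideals $R\subseteq T$ of $F$ with $L=F/R$ and $Z=T/R$, so that $L/L'=F/(R+F')$, $M(L)=\frac{R\cap F'}{F\lozenge R+R\lozenge F}$, $M(L/Z)=\frac{T\cap F'}{F\lozenge T+T\lozenge F}$ and $L'\cap Z=\frac{T\cap(F'+R)}{R}$.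 The maps $M(L)\to M(L/Z)$ (the natural map) and $M(L/Z)\to L'\cap Z$ are induced by the inclusions $R\cap F'\subseteq T\cap F'$ and $T\cap F'\subseteq T\cap(F'+R)$. The first map is the linear map $(a,b,c,d)\mapsto\overline{\alpha_\dashv}(a)+\overline{\theta_\dashv}(b)+\overline{\alpha_\vdash}(c)+\overline{\theta_\vdash}(d)$ on $\left(\frac{F}{R+F'}\otimes\frac{T}{R}\oplus\frac{T}{R}\otimes\frac{F}{R+F'}\right)^2$, where, for $*\in\{\dashv,\vdash\}$, $\overline{\alpha_*}(\bar f\otimes\bar t)=f*t+(F\lozenge R+R\lozenge F)$ and $\overline{\theta_*}(\bar t\otimes\bar f)=t*f+(F\lozenge R+R\lozenge F)$ for $f\in F$, $t\in T$ (these are well defined). *)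

theory Defs
  imports "Jordan_Normal_Form.Missing_VectorSpace" "HOL-Algebra.AbelCoset"
begin

text \<open>
  Vector spaces are those of the locale \<^locale>\<open>vectorspace\<close>: a field \<open>K\<close> and a module record
  over \<open>K\<close>. As in HOL-Algebra's treatment of modules, the ring multiplication and unit
  contained in a module record are never used. A subspace \<open>W\<close> of \<open>V\<close>, regarded as a vector
  space of its own, is \<open>V\<lparr>carrier := W\<rparr>\<close>.
\<close>

section \<open>Bilinear maps and quotient spaces\<close>

definition bilinear_map ::
  "'k ring \<Rightarrow> ('k, 'u, 'x) module_scheme \<Rightarrow> ('k, 'v, 'y) module_scheme \<Rightarrow> ('k, 'w, 'z) module_scheme
    \<Rightarrow> ('u \<Rightarrow> 'v \<Rightarrow> 'w) \<Rightarrow> bool"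
  where "bilinear_map K U V W b \<longleftrightarrow>
    (\<forall>u\<in>carrier U. b u \<in> module_hom K V W) \<and>
    (\<forall>v\<in>carrier V. (\<lambda>u. b u v) \<in> module_hom K U W)"

text \<open>For a subspace \<open>W\<close> all members of the union defining the scalar multiplication are one and the
  same coset. The same encoding is used for the products of a quotient algebra below.\<close>

definition quot_space :: "('k, 'v, 'x) module_scheme \<Rightarrow> 'v set \<Rightarrow> ('k, 'v set) module"
  where "quot_space V W =
    \<lparr>carrier = a_rcosets\<^bsub>V\<^esub> W,
     mult = (\<lambda>C D. W),
     one = W,
     zero = W,
     add = set_add V,
     smult = (\<lambda>c C. \<Union>x\<in>C. W +>\<^bsub>V\<^esub> (c \<odot>\<^bsub>V\<^esub> x))\<rparr>"

section \<open>Tensor products\<close>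

definition free_space :: "'k ring \<Rightarrow> 's set \<Rightarrow> ('k, 's \<Rightarrow> 'k) module"
  where "free_space K S =
    \<lparr>carrier = {f. (\<forall>s. f s \<in> carrier K) \<and> (\<forall>s. s \<notin> S \<longrightarrow> f s = \<zero>\<^bsub>K\<^esub>) \<and> finite {s. f s \<noteq> \<zero>\<^bsub>K\<^esub>}},
     mult = (\<lambda>f g s. \<zero>\<^bsub>K\<^esub>),
     one = (\<lambda>s. \<zero>\<^bsub>K\<^esub>),
     zero = (\<lambda>s. \<zero>\<^bsub>K\<^esub>),
     add = (\<lambda>f g s. f s \<oplus>\<^bsub>K\<^esub> g s),
     smult = (\<lambda>c f s. c \<otimes>\<^bsub>K\<^esub> f s)\<rparr>"

definition free_gen :: "'k ring \<Rightarrow> 's \<Rightarrow> 's \<Rightarrow> 'k"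
  where "free_gen K s = (\<lambda>t. if t = s then \<one>\<^bsub>K\<^esub> else \<zero>\<^bsub>K\<^esub>)"

definition tensor_relations ::
  "'k ring \<Rightarrow> ('k, 'u, 'x) module_scheme \<Rightarrow> ('k, 'v, 'y) module_scheme \<Rightarrow> ('u \<times> 'v \<Rightarrow> 'k) set"
  where "tensor_relations K U V =
    (let E = free_space K (carrier U \<times> carrier V); \<delta> = (\<lambda>u v. free_gen K (u, v)) in
      {\<delta> (u \<oplus>\<^bsub>U\<^esub> u') v \<ominus>\<^bsub>E\<^esub> (\<delta> u v \<oplus>\<^bsub>E\<^esub> \<delta> u' v) | u u' v.
         u \<in> carrier U \<and> u' \<in> carrier U \<and> v \<in> carrier V} \<union>
      {\<delta> u (v \<oplus>\<^bsub>V\<^esub> v') \<ominus>\<^bsub>E\<^esub> (\<delta> u v \<oplus>\<^bsub>E\<^esub> \<delta> u v') | u v v'.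
         u \<in> carrier U \<and> v \<in> carrier V \<and> v' \<in> carrier V} \<union>
      {\<delta> (c \<odot>\<^bsub>U\<^esub> u) v \<ominus>\<^bsub>E\<^esub> (c \<odot>\<^bsub>E\<^esub> \<delta> u v) | c u v.
         c \<in> carrier K \<and> u \<in> carrier U \<and> v \<in> carrier V} \<union>
      {\<delta> u (c \<odot>\<^bsub>V\<^esub> v) \<ominus>\<^bsub>E\<^esub> (c \<odot>\<^bsub>E\<^esub> \<delta> u v) | c u v.
         c \<in> carrier K \<and> u \<in> carrier U \<and> v \<in> carrier V})"

definition tensor_kernel ::
  "'k ring \<Rightarrow> ('k, 'u, 'x) module_scheme \<Rightarrow> ('k, 'v, 'y) module_scheme \<Rightarrow> ('u \<times> 'v \<Rightarrow> 'k) set"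
  where "tensor_kernel K U V =
    module.span K (free_space K (carrier U \<times> carrier V)) (tensor_relations K U V)"

definition tensor_space ::
  "'k ring \<Rightarrow> ('k, 'u, 'x) module_scheme \<Rightarrow> ('k, 'v, 'y) module_scheme
    \<Rightarrow> ('k, ('u \<times> 'v \<Rightarrow> 'k) set) module"
  where "tensor_space K U V =
    quot_space (free_space K (carrier U \<times> carrier V)) (tensor_kernel K U V)"

definition pure_tensor ::
  "'k ring \<Rightarrow> ('k, 'u, 'x) module_scheme \<Rightarrow> ('k, 'v, 'y) module_scheme \<Rightarrow> 'u \<Rightarrow> 'v
    \<Rightarrow> ('u \<times> 'v \<Rightarrow> 'k) set"
  where "pure_tensor K U V u v =
    tensor_kernel K U V +>\<^bsub>free_space K (carrier U \<times> carrier V)\<^esub> free_gen K (u, v)"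

section \<open>Diassociative algebras\<close>

record ('k, 'a) dialgebra = "('k, 'a) module" +
  dleft :: "'a \<Rightarrow> 'a \<Rightarrow> 'a" (infixl \<open>\<stileturn>\<index>\<close> 70)
  dright :: "'a \<Rightarrow> 'a \<Rightarrow> 'a" (infixl \<open>\<turnstile>\<index>\<close> 70)

locale diassociative_algebra = vectorspace K A
  for K :: "'k ring" and A :: "('k, 'a, 'm) dialgebra_scheme" (structure) +
  assumes dleft_bilinear: "bilinear_map K A A A (dleft A)"
    and dright_bilinear: "bilinear_map K A A A (dright A)"
    and dleft_assoc: "\<lbrakk>x \<in> carrier A; y \<in> carrier A; z \<in> carrier A\<rbrakk>
      \<Longrightarrow> (x \<stileturn> y) \<stileturn> z = x \<stileturn> (y \<stileturn> z)"
    and dright_assoc: "\<lbrakk>x \<in> carrier A; y \<in> carrier A; z \<in> carrier A\<rbrakk>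
      \<Longrightarrow> (x \<turnstile> y) \<turnstile> z = x \<turnstile> (y \<turnstile> z)"
    and dleft_dright: "\<lbrakk>x \<in> carrier A; y \<in> carrier A; z \<in> carrier A\<rbrakk>
      \<Longrightarrow> x \<stileturn> (y \<stileturn> z) = x \<stileturn> (y \<turnstile> z)"
    and dright_dleft_assoc: "\<lbrakk>x \<in> carrier A; y \<in> carrier A; z \<in> carrier A\<rbrakk>
      \<Longrightarrow> (x \<turnstile> y) \<stileturn> z = x \<turnstile> (y \<stileturn> z)"
    and dleft_dright': "\<lbrakk>x \<in> carrier A; y \<in> carrier A; z \<in> carrier A\<rbrakk>
      \<Longrightarrow> (x \<stileturn> y) \<turnstile> z = (x \<turnstile> y) \<turnstile> z"

definition dleft_span :: "'k ring \<Rightarrow> ('k, 'a, 'm) dialgebra_scheme \<Rightarrow> 'a set \<Rightarrow> 'a set \<Rightarrow> 'a set"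
  where "dleft_span K A X Y = module.span K A {x \<stileturn>\<^bsub>A\<^esub> y | x y. x \<in> X \<and> y \<in> Y}"

definition dright_span :: "'k ring \<Rightarrow> ('k, 'a, 'm) dialgebra_scheme \<Rightarrow> 'a set \<Rightarrow> 'a set \<Rightarrow> 'a set"
  where "dright_span K A X Y = module.span K A {x \<turnstile>\<^bsub>A\<^esub> y | x y. x \<in> X \<and> y \<in> Y}"

text \<open>\<open>X \<lozenge> Y\<close>\<close>

definition lozenge :: "'k ring \<Rightarrow> ('k, 'a, 'm) dialgebra_scheme \<Rightarrow> 'a set \<Rightarrow> 'a set \<Rightarrow> 'a set"
  where "lozenge K A X Y = module.submodule_sum A (dleft_span K A X Y) (dright_span K A X Y)"

definition derived :: "'k ring \<Rightarrow> ('k, 'a, 'm) dialgebra_scheme \<Rightarrow> 'a set"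
  where "derived K A = lozenge K A (carrier A) (carrier A)"

definition dialg_center :: "('k, 'a, 'm) dialgebra_scheme \<Rightarrow> 'a set"
  where "dialg_center A = {z \<in> carrier A. \<forall>x\<in>carrier A.
    z \<stileturn>\<^bsub>A\<^esub> x = \<zero>\<^bsub>A\<^esub> \<and> x \<stileturn>\<^bsub>A\<^esub> z = \<zero>\<^bsub>A\<^esub> \<and> z \<turnstile>\<^bsub>A\<^esub> x = \<zero>\<^bsub>A\<^esub> \<and> x \<turnstile>\<^bsub>A\<^esub> z = \<zero>\<^bsub>A\<^esub>}"

definition dialg_ideal :: "'k ring \<Rightarrow> ('k, 'a, 'm) dialgebra_scheme \<Rightarrow> 'a set \<Rightarrow> bool"
  where "dialg_ideal K A I \<longleftrightarrow> subspace K I A \<and>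
    (\<forall>x\<in>carrier A. \<forall>i\<in>I. x \<stileturn>\<^bsub>A\<^esub> i \<in> I \<and> i \<stileturn>\<^bsub>A\<^esub> x \<in> I \<and> x \<turnstile>\<^bsub>A\<^esub> i \<in> I \<and> i \<turnstile>\<^bsub>A\<^esub> x \<in> I)"

definition central_ideal :: "'k ring \<Rightarrow> ('k, 'a, 'm) dialgebra_scheme \<Rightarrow> 'a set \<Rightarrow> bool"
  where "central_ideal K A I \<longleftrightarrow> dialg_ideal K A I \<and> I \<subseteq> dialg_center A"

definition quot_dialgebra :: "('k, 'a, 'm) dialgebra_scheme \<Rightarrow> 'a set \<Rightarrow> ('k, 'a set) dialgebra"
  where "quot_dialgebra A I = module.extend (quot_space A I)
    (dialgebra.fields
      (\<lambda>C D. \<Union>x\<in>C. \<Union>y\<in>D. I +>\<^bsub>A\<^esub> (x \<stileturn>\<^bsub>A\<^esub> y))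
      (\<lambda>C D. \<Union>x\<in>C. \<Union>y\<in>D. I +>\<^bsub>A\<^esub> (x \<turnstile>\<^bsub>A\<^esub> y)))"

definition dialg_hom ::
  "'k ring \<Rightarrow> ('k, 'a, 'm) dialgebra_scheme \<Rightarrow> ('k, 'b, 'n) dialgebra_scheme \<Rightarrow> ('a \<Rightarrow> 'b) set"
  where "dialg_hom K A B = {h \<in> module_hom K A B. \<forall>x\<in>carrier A. \<forall>y\<in>carrier A.
    h (x \<stileturn>\<^bsub>A\<^esub> y) = h x \<stileturn>\<^bsub>B\<^esub> h y \<and> h (x \<turnstile>\<^bsub>A\<^esub> y) = h x \<turnstile>\<^bsub>B\<^esub> h y}"

definition dialg_isomorphic ::
  "'k ring \<Rightarrow> ('k, 'a, 'm) dialgebra_scheme \<Rightarrow> ('k, 'b, 'n) dialgebra_scheme \<Rightarrow> bool"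
  where "dialg_isomorphic K A B \<longleftrightarrow> (\<exists>h\<in>dialg_hom K A B. bij_betw h (carrier A) (carrier B))"

text \<open>
  \<open>F\<close> is free on \<open>X\<close>: the universal property, which has to be tested against algebras whose
  elements live in a given type \<open>'c\<close>, since HOL cannot quantify over types inside a formula.
  A free algebra has this property for every \<open>'c\<close>, so a theorem that assumes it for one
  arbitrary \<open>'c\<close> applies to all free algebras.
\<close>

definition free_diassociative ::
  "'c itself \<Rightarrow> 'k ring \<Rightarrow> ('k, 'a) dialgebra \<Rightarrow> 'a set \<Rightarrow> bool"
  where "free_diassociative _ K F X \<longleftrightarrow>
    diassociative_algebra K F \<and> X \<subseteq> carrier F \<and>
    (\<forall>(A :: ('k, 'c) dialgebra) g. diassociative_algebra K A \<and> g \<in> X \<rightarrow> carrier A \<longrightarrow>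
      (\<exists>h\<in>dialg_hom K F A. (\<forall>x\<in>X. h x = g x) \<and>
        (\<forall>h'\<in>dialg_hom K F A. (\<forall>x\<in>X. h' x = g x) \<longrightarrow> (\<forall>y\<in>carrier F. h' y = h y))))"

section \<open>The multiplier\<close>

definition defining_pair ::
  "'k ring \<Rightarrow> ('k, 'l) dialgebra \<Rightarrow> ('k, 'p) dialgebra \<Rightarrow> 'p set \<Rightarrow> bool"
  where "defining_pair K L P M \<longleftrightarrow>
    diassociative_algebra K P \<and> dialg_ideal K P M \<and>
    dialg_isomorphic K L (quot_dialgebra P M) \<and>
    M \<subseteq> dialg_center P \<inter> derived K P"

text \<open>
  \<open>V\<close> is a multiplier of \<open>L\<close>, for \<open>L\<close> of finite dimension, where every defining pair
  consists of finite-dimensional spaces. All products vanish on an \<open>M\<close> contained in the center,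
  so \<open>V\<close> is only given as a vector space and compared with \<open>M\<close> by a linear isomorphism.
  The type \<open>'c\<close> bounds the defining pairs among which \<open>P\<close> is required to be
  maximal; the full notion is that the predicate holds for every \<open>'c\<close>.
  Finite-dimensionality is spelled out because \<^const>\<open>vectorspace.dim\<close> is unspecified otherwise.
\<close>

definition is_multiplier ::
  "'c itself \<Rightarrow> 'k ring \<Rightarrow> ('k, 'l) dialgebra \<Rightarrow> ('k, 'v) module \<Rightarrow> bool"
  where "is_multiplier _ K L V \<longleftrightarrow>
    (\<exists>(P :: ('k, 'v) dialgebra) M.
      defining_pair K L P M \<and> vectorspace.fin_dim K P \<and>
      (\<forall>(P' :: ('k, 'c) dialgebra) M'. defining_pair K L P' M' \<longrightarrow>
        vectorspace.fin_dim K P' \<and> vectorspace.dim K P' \<le> vectorspace.dim K P) \<and>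
      (\<exists>h. linear_map K V (P\<lparr>carrier := M\<rparr>) h \<and> bij_betw h (carrier V) M))"

text \<open>The subspace \<open>F \<lozenge> R + R \<lozenge> F\<close> and the quotient \<open>(R \<inter> F') / (F \<lozenge> R + R \<lozenge> F)\<close>\<close>

definition hopf_denom :: "'k ring \<Rightarrow> ('k, 'f) dialgebra \<Rightarrow> 'f set \<Rightarrow> 'f set"
  where "hopf_denom K F R =
    module.submodule_sum F (lozenge K F (carrier F) R) (lozenge K F R (carrier F))"

definition hopf_quotient :: "'k ring \<Rightarrow> ('k, 'f) dialgebra \<Rightarrow> 'f set \<Rightarrow> ('k, 'f set) module"
  where "hopf_quotient K F R =
    quot_space (F\<lparr>carrier := R \<inter> derived K F\<rparr>) (hopf_denom K F R)"

section \<open>Exactness\<close>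

definition exact_at ::
  "'k ring \<Rightarrow> ('k, 'u, 'x) module_scheme \<Rightarrow> ('u \<Rightarrow> 'v) \<Rightarrow> ('k, 'v, 'y) module_scheme \<Rightarrow> ('v \<Rightarrow> 'w)
    \<Rightarrow> ('k, 'w, 'z) module_scheme \<Rightarrow> bool"
  where "exact_at K U f V g W \<longleftrightarrow>
    linear_map K U V f \<and> linear_map K V W g \<and>
    f ` carrier U = {v \<in> carrier V. g v = \<zero>\<^bsub>W\<^esub>}"

end

theory Submission
  imports Defs
begin

text \<open>
  Write \<open>D\<^sub>R = F \<lozenge> R + R \<lozenge> F\<close>. That \<open>(R \<inter> F') / D\<^sub>R\<close> is the multiplier of \<open>F/R\<close> is seen as
  follows. Choose a complement \<open>S/D\<^sub>R\<close> of \<open>(R \<inter> F')/D\<^sub>R\<close> in \<open>R/D\<^sub>R\<close>; since \<open>D\<^sub>R \<subseteq> S \<subseteq> R\<close>, \<open>S\<close> is an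
  ideal, and \<open>(F/S, R/S)\<close> is a defining pair with \<open>R/S \<cong> (R \<inter> F')/D\<^sub>R\<close>. For any defining pair
  \<open>(P, M)\<close> the projection \<open>F \<rightarrow> L \<cong> P/M\<close> lifts to \<open>k : F \<rightarrow> P\<close>. As \<open>M\<close> is central, \<open>P = k(F) + M\<close>
  gives \<open>P' \<subseteq> k(F')\<close>, so \<open>k\<close> maps \<open>R \<inter> F'\<close> onto \<open>M\<close> and kills \<open>D\<^sub>R\<close>. Hence
  \<open>dim P = dim L + dim M\<close> is largest for \<open>(F/S, R/S)\<close>.

  In the Ganea sequence, centrality of \<open>Z\<close> means \<open>D\<^sub>T \<subseteq> R \<inter> F'\<close>, and the axioms of a diassociative
  algebra move every product of \<open>F'\<close> and \<open>T\<close> into \<open>D\<^sub>R\<close>, so the four pairings descend to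
  \<open>L/L'\<close> and \<open>Z\<close>. The image of the first map and the kernel of the second are both \<open>D\<^sub>T/D\<^sub>R\<close>, and
  the image of the second map and the kernel of the third are both \<open>(R \<inter> F')/D\<^sub>T\<close>.
\<close>

section \<open>Linear algebra\<close>

text \<open>Two finiteness issues lie behind the dimension count. \<open>F\<close> and
  \<open>R\<close> are infinite-dimensional in general, so \<open>S\<close> has to come from Zorn's
  lemma and dimensions are taken only of quotients. And maximality makes sense only if every
  defining pair \<open>(P, M)\<close> is finite-dimensional. This holds because \<open>M\<close> is
  both central and contained in \<open>P'\<close>: lifts of a finite spanning set of
  \<open>L\<close> span \<open>P\<close> up to \<open>M\<close>, their pairwise products span
  \<open>P'\<close> by centrality, and \<open>M\<close> lies in \<open>P'\<close>.

  For exactness, no element of a tensor product is ever expanded into a sum. That pure tensors span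
  is carried along in another form: a map induced by a bilinear map sends the whole tensor product
  into every subspace that contains the values of the bilinear map. With the kernel of the second
  map as this subspace, one inclusion follows; the other one is checked on the products that
  generate \<open>D\<^sub>T\<close>.\<close>

lemma linear_mapI:
  assumes "vectorspace K V" "vectorspace K W" "f \<in> module_hom K V W"
  shows "linear_map K V W f"
  using assms by (simp add: linear_map_def mod_hom_def mod_hom_axioms_def vectorspace_def)

lemma linear_mapD:
  assumes "linear_map K V W f"
  shows "vectorspace K V" "vectorspace K W" "f \<in> module_hom K V W"
  using assms by (simp_all add: linear_map_def mod_hom_def mod_hom_axioms_def)

lemma module_homI:
  assumes "\<And>x. x \<in> carrier V \<Longrightarrow> f x \<in> carrier W"
    and "\<And>x y. \<lbrakk>x \<in> carrier V; y \<in> carrier V\<rbrakk> \<Longrightarrow> f (x \<oplus>\<^bsub>V\<^esub> y) = f x \<oplus>\<^bsub>W\<^esub> f y"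
    and "\<And>c x. \<lbrakk>c \<in> carrier K; x \<in> carrier V\<rbrakk> \<Longrightarrow> f (c \<odot>\<^bsub>V\<^esub> x) = c \<odot>\<^bsub>W\<^esub> f x"
  shows "f \<in> module_hom K V W"
  using assms by (simp add: module_hom_def)

lemma module_hom_in: "\<lbrakk>f \<in> module_hom K V W; x \<in> carrier V\<rbrakk> \<Longrightarrow> f x \<in> carrier W"
  by (auto simp: module_hom_def)

lemma linear_map_zero:
  assumes "linear_map K V W f" shows "f \<zero>\<^bsub>V\<^esub> = \<zero>\<^bsub>W\<^esub>"
proof -
  interpret linear_map K V W f by fact
  show ?thesis by (rule T0_is_0)
qed

lemma linear_map_compose:
  assumes "linear_map K U V f" "linear_map K V W g"
  shows "linear_map K U W (\<lambda>x. g (f x))"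
  using assms[THEN linear_mapD(1)] assms[THEN linear_mapD(2)] assms[THEN linear_mapD(3)]
  by (intro linear_mapI) (auto simp: module_hom_def Pi_def)

lemma linear_map_cong:
  assumes "linear_map K V W f" "\<And>x. x \<in> carrier V \<Longrightarrow> g x = f x"
  shows "linear_map K V W g"
proof -
  interpret linear_map K V W f by fact
  show ?thesis
    using assms by (intro linear_mapI V.vectorspace_axioms W.vectorspace_axioms module_homI) auto
qed

lemma subspaceI:
  assumes "vectorspace K V" "W \<subseteq> carrier V" "\<zero>\<^bsub>V\<^esub> \<in> W"
    and "\<And>x y. \<lbrakk>x \<in> W; y \<in> W\<rbrakk> \<Longrightarrow> x \<oplus>\<^bsub>V\<^esub> y \<in> W"
    and "\<And>c x. \<lbrakk>c \<in> carrier K; x \<in> W\<rbrakk> \<Longrightarrow> c \<odot>\<^bsub>V\<^esub> x \<in> W"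
  shows "subspace K W V"
  using assms by (simp add: subspace_def submodule_def vectorspace_def)

lemma subspaceD:
  assumes "subspace K W V"
  shows "vectorspace K V" "W \<subseteq> carrier V" "\<zero>\<^bsub>V\<^esub> \<in> W"
    and "\<lbrakk>x \<in> W; y \<in> W\<rbrakk> \<Longrightarrow> x \<oplus>\<^bsub>V\<^esub> y \<in> W"
    and "\<lbrakk>c \<in> carrier K; x \<in> W\<rbrakk> \<Longrightarrow> c \<odot>\<^bsub>V\<^esub> x \<in> W"
    and "x \<in> W \<Longrightarrow> x \<in> carrier V"
  using assms by (auto simp: subspace_def submodule_def)

lemma subspace_neg:
  assumes "subspace K W V" "x \<in> W" shows "\<ominus>\<^bsub>V\<^esub> x \<in> W"
proof -
  interpret vectorspace K V using subspaceD(1)[OF assms(1)] .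
  have "\<ominus>\<^bsub>V\<^esub> x = (\<ominus>\<^bsub>K\<^esub> \<one>\<^bsub>K\<^esub>) \<odot>\<^bsub>V\<^esub> x"
    using subspaceD(6)[OF assms] by (simp add: smult_minus_1)
  then show ?thesis using subspaceD(5)[OF assms(1) _ assms(2)] by simp
qed

lemma subspace_carrier: "vectorspace K V \<Longrightarrow> subspace K (carrier V) V"
proof -
  assume "vectorspace K V"
  then interpret vectorspace K V .
  show ?thesis by (rule subspaceI[OF vectorspace_axioms]) auto
qed

lemma subspace_zero: "vectorspace K V \<Longrightarrow> subspace K {\<zero>\<^bsub>V\<^esub>} V"
proof -
  assume "vectorspace K V"
  then interpret vectorspace K V .
  show ?thesis by (rule subspaceI[OF vectorspace_axioms]) auto
qed

lemma subspace_Int: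
  assumes "subspace K W V" "subspace K W' V" shows "subspace K (W \<inter> W') V"
  using assms[THEN subspaceD(1)] assms[THEN subspaceD(2)] assms[THEN subspaceD(3)]
    assms[THEN subspaceD(4)] assms[THEN subspaceD(5)]
  by (intro subspaceI) auto

lemma subspace_vectorspace: "subspace K W V \<Longrightarrow> vectorspace K (V\<lparr>carrier := W\<rparr>)"
  by (rule vectorspace.subspace_is_vs) (auto dest: subspaceD)

lemma subspace_in_subspace:
  assumes "subspace K W V" "subspace K U V" "W \<subseteq> U"
  shows "subspace K W (V\<lparr>carrier := U\<rparr>)"
  using assms(3) subspaceD[OF assms(1)]
  by (intro subspaceI subspace_vectorspace assms(2)) auto

lemma subspace_preimage:
  assumes "linear_map K V W f" "subspace K N W"
  shows "subspace K {x \<in> carrier V. f x \<in> N} V"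
proof -
  interpret linear_map K V W f by fact
  show ?thesis
    using subspaceD[OF assms(2)] by (intro subspaceI[OF V.vectorspace_axioms]) auto
qed

lemma subspace_image:
  assumes "linear_map K V W f" "subspace K N V"
  shows "subspace K (f ` N) W"
proof -
  interpret linear_map K V W f by fact
  note N = subspaceD[OF assms(2)]
  show ?thesis
  proof (rule subspaceI[OF W.vectorspace_axioms])
    show "f ` N \<subseteq> carrier W" using N(2) by auto
    show "\<zero>\<^bsub>W\<^esub> \<in> f ` N" using N(3) T0_is_0 by (metis image_eqI)
  next
    fix x y assume "x \<in> f ` N" "y \<in> f ` N"
    then obtain a b where ab: "a \<in> N" "x = f a" "b \<in> N" "y = f b" by auto
    then have "x \<oplus>\<^bsub>W\<^esub> y = f (a \<oplus>\<^bsub>V\<^esub> b)" using N(6) by simp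
    then show "x \<oplus>\<^bsub>W\<^esub> y \<in> f ` N" using N(4) ab by blast
  next
    fix c x assume c: "c \<in> carrier K" and "x \<in> f ` N"
    then obtain a where a: "a \<in> N" "x = f a" by auto
    then have "c \<odot>\<^bsub>W\<^esub> x = f (c \<odot>\<^bsub>V\<^esub> a)" using N(6) c by simp
    then show "c \<odot>\<^bsub>W\<^esub> x \<in> f ` N" using N(5) c a by blast
  qed
qed

lemma linear_map_restrict:
  assumes "linear_map K V W f" "subspace K N V" "subspace K N' W"
    and "\<And>x. x \<in> N \<Longrightarrow> f x \<in> N'"
  shows "linear_map K (V\<lparr>carrier := N\<rparr>) (W\<lparr>carrier := N'\<rparr>) f"
proof -
  interpret linear_map K V W f by fact
  show ?thesis
    using assms(4) subspaceD(6)[OF assms(2)]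
    by (intro linear_mapI subspace_vectorspace assms(2,3) module_homI) auto
qed

lemma linear_map_restrict_domain:
  assumes "linear_map K V W f" "subspace K N V"
  shows "linear_map K (V\<lparr>carrier := N\<rparr>) W f"
proof -
  interpret linear_map K V W f by fact
  show ?thesis
    using subspaceD(6)[OF assms(2)]
    by (intro linear_mapI subspace_vectorspace assms(2) W.vectorspace_axioms module_homI) auto
qed

lemma span_least:
  assumes "subspace K N V" "S \<subseteq> N" shows "module.span K V S \<subseteq> N"
proof -
  interpret vectorspace K V using subspaceD(1)[OF assms(1)] .
  show ?thesis using assms by (intro span_is_subset) (auto simp: subspace_def)
qed

text \<open>\<open>module_hom\<close> does not presuppose that its target is a vector space. Every
  element of \<open>Q\<close> has the form \<open>q x\<close>, so each axiom for \<open>Q\<close> is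
  the image under \<open>q\<close> of the same axiom for \<open>V\<close>. Quotients therefore need
  no axiom check of their own.\<close>

lemma vectorspace_surj_image:
  assumes "vectorspace K V" "q \<in> module_hom K V Q" "q ` carrier V = carrier Q"
    and zero: "q \<zero>\<^bsub>V\<^esub> = \<zero>\<^bsub>Q\<^esub>"
  shows "vectorspace K Q"
proof -
  interpret vectorspace K V by fact
  have add: "q (x \<oplus>\<^bsub>V\<^esub> y) = q x \<oplus>\<^bsub>Q\<^esub> q y" if "x \<in> carrier V" "y \<in> carrier V" for x y
    using assms(2) that by (simp add: module_hom_add)
  have smult: "q (c \<odot>\<^bsub>V\<^esub> x) = c \<odot>\<^bsub>Q\<^esub> q x" if "c \<in> carrier K" "x \<in> carrier V" for c x
    using assms(2) that by (simp add: module_hom_smult)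
  have ex: "\<exists>x\<in>carrier V. v = q x" if "v \<in> carrier Q" for v
    using that assms(3) by blast
  have in': "q x \<in> carrier Q" if "x \<in> carrier V" for x
    using that assms(3) by blast
  show ?thesis
  proof (rule vs_criteria, goal_cases)
    case 1 show ?case by (rule field_axioms)
  next
    case 2 show ?case using in'[of "\<zero>\<^bsub>V\<^esub>"] zero by simp
  next
    case 3 show ?case by (auto dest!: ex simp: add[symmetric] in')
  next
    case 4 show ?case
    proof
      fix v assume "v \<in> carrier Q"
      then obtain x where x: "x \<in> carrier V" "v = q x" using ex by blast
      have "v \<oplus>\<^bsub>Q\<^esub> q (\<ominus>\<^bsub>V\<^esub> x) = \<zero>\<^bsub>Q\<^esub>"
        using x by (simp add: add[symmetric] zero M.r_neg)
      then show "\<exists>v'\<in>carrier Q. v \<oplus>\<^bsub>Q\<^esub> v' = \<zero>\<^bsub>Q\<^esub>" using x in' by (meson M.a_inv_closed)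
    qed
  next
    case 5 show ?case by (auto dest!: ex simp: smult[symmetric] in')
  next
    case 6 show ?case by (auto dest!: ex simp: add[symmetric] M.a_comm)
  next
    case 7 show ?case by (auto dest!: ex simp: add[symmetric] M.a_assoc)
  next
    case 8 show ?case by (auto dest!: ex simp: add[symmetric] zero[symmetric])
  next
    case 9 show ?case by (auto dest!: ex simp: smult[symmetric] smult_assoc1)
  next
    case 10 show ?case by (auto dest!: ex simp: smult[symmetric])
  next
    case 11 show ?case by (auto dest!: ex simp: smult[symmetric] add[symmetric] smult_l_distr)
  next
    case 12 show ?case by (auto dest!: ex simp: smult[symmetric] add[symmetric] smult_r_distr)
  qed
qed

section \<open>Linear maps and their kernels\<close>

lemma linear_map_eq_diff:
  assumes "linear_map K V W f" "x \<in> carrier V" "y \<in> carrier V" "f x = f y"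
  shows "f (x \<ominus>\<^bsub>V\<^esub> y) = \<zero>\<^bsub>W\<^esub>"
proof -
  interpret linear_map K V W f by fact
  show ?thesis using assms by (simp add: a_minus_def W.module.M.r_neg)
qed

lemma linear_map_eq_of_diff:
  assumes "linear_map K V W f" "x \<in> carrier V" "y \<in> carrier V" "f (x \<ominus>\<^bsub>V\<^esub> y) = \<zero>\<^bsub>W\<^esub>"
  shows "f x = f y"
proof -
  interpret linear_map K V W f by fact
  have "f x \<ominus>\<^bsub>W\<^esub> f y = \<zero>\<^bsub>W\<^esub>" using assms by (simp add: a_minus_def)
  then show ?thesis using assms by simp
qed

text \<open>The value at \<open>y\<close> is \<open>f\<close> of a chosen preimage of
  \<open>y\<close>. Two preimages differ by an element of the kernel of \<open>q\<close>, where
  \<open>f\<close> vanishes, so the choice does not matter. Stated for an arbitrary surjection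
  \<open>q\<close>, it covers coset maps as well as bijections.\<close>

lemma linear_map_factor:
  assumes q: "linear_map K V Q q" "q ` carrier V = carrier Q"
    and f: "linear_map K V W f"
    and ker: "\<And>x. \<lbrakk>x \<in> carrier V; q x = \<zero>\<^bsub>Q\<^esub>\<rbrakk> \<Longrightarrow> f x = \<zero>\<^bsub>W\<^esub>"
  obtains g where "linear_map K Q W g" "\<And>x. x \<in> carrier V \<Longrightarrow> g (q x) = f x"
proof -
  interpret Q: linear_map K V Q q by fact
  interpret F: linear_map K V W f by fact
  define g where "g y = f (inv_into (carrier V) q y)" for y
  have g: "g (q x) = f x" if x: "x \<in> carrier V" for x
  proof -
    define x' where "x' = inv_into (carrier V) q (q x)"
    have x': "x' \<in> carrier V" "q x' = q x"
      using x by (auto simp: x'_def f_inv_into_f inv_into_into)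
    have "f x' = f x"
      using x x' by (intro linear_map_eq_of_diff[OF f] ker linear_map_eq_diff[OF q(1)]
          Q.V.module.M.minus_closed)
    then show ?thesis by (simp add: g_def x'_def)
  qed
  have ex: "\<exists>x\<in>carrier V. y = q x" if "y \<in> carrier Q" for y
    using that q(2) by blast
  have "linear_map K Q W g"
    by (intro linear_mapI Q.W.vectorspace_axioms F.W.vectorspace_axioms module_homI)
      (auto dest!: ex simp: g Q.T_add[symmetric] Q.T_smult[symmetric]
        simp del: Q.T_add Q.T_smult)
  then show thesis using g that by blast
qed

text \<open>The inverse is the identity of \<open>V\<close> factored through
  \<open>f\<close>.\<close>

lemma linear_map_inv:
  assumes "linear_map K V W f" "bij_betw f (carrier V) (carrier W)"
  shows "linear_map K W V (inv_into (carrier V) f)"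
proof -
  interpret linear_map K V W f by fact
  have surj: "f ` carrier V = carrier W" and inj: "inj_on f (carrier V)"
    using assms(2) by (auto simp: bij_betw_def)
  have "linear_map K V V (\<lambda>x. x)"
    by (intro linear_mapI module_homI V.vectorspace_axioms) auto
  moreover have "x = \<zero>\<^bsub>V\<^esub>" if "x \<in> carrier V" "f x = \<zero>\<^bsub>W\<^esub>" for x
    using that inj T0_is_0 V.module.M.zero_closed by (metis inj_onD)
  ultimately obtain g where g: "linear_map K W V g" "\<And>x. x \<in> carrier V \<Longrightarrow> g (f x) = x"
    using linear_map_factor[OF assms(1) surj] by metis
  show ?thesis
  proof (rule linear_map_cong[OF g(1)])
    fix y assume "y \<in> carrier W"
    then obtain x where "x \<in> carrier V" "y = f x" using surj by blast
    then show "inv_into (carrier V) f y = g y" using inj g(2) by simp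
  qed
qed

lemma bij_betw_of_kernel:
  assumes "linear_map K V W f" "f ` carrier V = N"
    and "\<And>x. \<lbrakk>x \<in> carrier V; f x = \<zero>\<^bsub>W\<^esub>\<rbrakk> \<Longrightarrow> x = \<zero>\<^bsub>V\<^esub>"
  shows "bij_betw f (carrier V) N"
proof -
  interpret linear_map K V W f by fact
  have "x = y" if "x \<in> carrier V" "y \<in> carrier V" "f x = f y" for x y
  proof -
    have "x \<ominus>\<^bsub>V\<^esub> y = \<zero>\<^bsub>V\<^esub>"
      using that by (intro assms(3) linear_map_eq_diff[OF assms(1)]) auto
    then show ?thesis using that by simp
  qed
  then show ?thesis using assms(2) by (auto simp: bij_betw_def inj_on_def)
qed

lemma linear_map_dim:
  assumes "linear_map K V W f" "f ` carrier V = carrier W" "vectorspace.fin_dim K V"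
  shows "vectorspace.fin_dim K W"
    and "vectorspace.dim K V
      = vectorspace.dim K W + vectorspace.dim K (V\<lparr>carrier := {x \<in> carrier V. f x = \<zero>\<^bsub>W\<^esub>}\<rparr>)"
proof -
  interpret linear_map K V W f by fact
  show "vectorspace.fin_dim K W" using rank_nullity_main(2) assms by blast
  have "imT = carrier W" using assms by (simp add: im_def)
  then show "V.dim = W.dim + vectorspace.dim K (V.vs {x \<in> carrier V. f x = \<zero>\<^bsub>W\<^esub>})"
    using rank_nullity[OF assms(3)] by (simp add: ker_def)
qed


subsection \<open>Quotient spaces\<close>

lemma subspace_abelian_subgroup:
  assumes "subspace K W V" shows "abelian_subgroup W V"
proof -
  interpret vectorspace K V using subspaceD(1)[OF assms] .
  have "subgroup W (add_monoid V)"
    using subspaceD[OF assms] subspace_neg[OF assms]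
    by (intro subgroup.intro) (auto simp: a_inv_def)
  then show ?thesis
    by (intro abelian_subgroupI3 additive_subgroup.intro M.abelian_group_axioms)
qed

lemma coset_eq_zero_iff:
  assumes "subspace K W V" "x \<in> carrier V"
  shows "W +>\<^bsub>V\<^esub> x = W \<longleftrightarrow> x \<in> W"
proof -
  interpret abelian_subgroup W V by (rule subspace_abelian_subgroup) fact
  show ?thesis
    using assms(2) a_coset_join1 a_coset_join2 a_rcos_self a_subgroup additive_subgroup_axioms
      abelian_group_axioms
    by metis
qed

lemma coset_add_subspace:
  assumes "subspace K W V" "w \<in> W" "x \<in> carrier V"
  shows "W +>\<^bsub>V\<^esub> (w \<oplus>\<^bsub>V\<^esub> x) = W +>\<^bsub>V\<^esub> x"
proof -
  interpret abelian_subgroup W V by (rule subspace_abelian_subgroup) fact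
  have "(W +>\<^bsub>V\<^esub> w) +>\<^bsub>V\<^esub> x = W +>\<^bsub>V\<^esub> (w \<oplus>\<^bsub>V\<^esub> x)"
    using assms a_subset by (intro a_coset_add_assoc) auto
  moreover have "W +>\<^bsub>V\<^esub> w = W"
    using assms a_subset coset_eq_zero_iff[OF assms(1)] by auto
  ultimately show ?thesis by simp
qed

lemma mem_coset_iff: "y \<in> W +>\<^bsub>V\<^esub> x \<longleftrightarrow> (\<exists>w\<in>W. y = w \<oplus>\<^bsub>V\<^esub> x)"
  by (auto simp: a_r_coset_def')

lemma coset_restrict [simp]: "W +>\<^bsub>V\<lparr>carrier := U\<rparr>\<^esub> x = W +>\<^bsub>V\<^esub> x"
  by (simp add: a_r_coset_def')

lemma quot_space_sel [simp]:
  "zero (quot_space V W) = W"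
  "add (quot_space V W) = set_add V"
  "carrier (quot_space V W) = (\<lambda>x. W +>\<^bsub>V\<^esub> x) ` carrier V"
  by (auto simp: quot_space_def A_RCOSETS_def')

lemma coset_smult:
  assumes "subspace K W V" "c \<in> carrier K" "x \<in> carrier V"
  shows "(\<Union>y\<in>W +>\<^bsub>V\<^esub> x. W +>\<^bsub>V\<^esub> (c \<odot>\<^bsub>V\<^esub> y)) = W +>\<^bsub>V\<^esub> (c \<odot>\<^bsub>V\<^esub> x)"
proof -
  interpret vectorspace K V using subspaceD(1)[OF assms(1)] .
  note W = subspaceD[OF assms(1)]
  have "W +>\<^bsub>V\<^esub> (c \<odot>\<^bsub>V\<^esub> y) = W +>\<^bsub>V\<^esub> (c \<odot>\<^bsub>V\<^esub> x)" if "y \<in> W +>\<^bsub>V\<^esub> x" for y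
    using that assms W by (auto simp: mem_coset_iff smult_r_distr coset_add_subspace)
  moreover have "x \<in> W +>\<^bsub>V\<^esub> x"
    using assms(3) W(3) by (force simp: mem_coset_iff)
  ultimately show ?thesis by blast
qed

lemma coset_set_add:
  assumes "subspace K W V" "x \<in> carrier V" "y \<in> carrier V"
  shows "(W +>\<^bsub>V\<^esub> x) <+>\<^bsub>V\<^esub> (W +>\<^bsub>V\<^esub> y) = W +>\<^bsub>V\<^esub> (x \<oplus>\<^bsub>V\<^esub> y)"
proof -
  interpret abelian_subgroup W V by (rule subspace_abelian_subgroup) fact
  show ?thesis using assms by (intro a_rcos_sum)
qed

lemma coset_module_hom:
  assumes "subspace K W V"
  shows "(\<lambda>x. W +>\<^bsub>V\<^esub> x) \<in> module_hom K V (quot_space V W)"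
  using assms
  by (intro module_homI) (auto simp: coset_set_add quot_space_def coset_smult A_RCOSETS_def')

lemma quot_space_vectorspace:
  assumes "subspace K W V" shows "vectorspace K (quot_space V W)"
proof (rule vectorspace_surj_image[OF subspaceD(1)[OF assms] coset_module_hom[OF assms]])
  interpret vectorspace K V using subspaceD(1)[OF assms] .
  show "W +>\<^bsub>V\<^esub> \<zero>\<^bsub>V\<^esub> = \<zero>\<^bsub>quot_space V W\<^esub>"
    using assms by (simp add: coset_eq_zero_iff subspaceD(3))
qed simp

lemma coset_linear_map:
  assumes "subspace K W V"
  shows "linear_map K V (quot_space V W) (\<lambda>x. W +>\<^bsub>V\<^esub> x)"
  using assms by (intro linear_mapI subspaceD(1)[OF assms] quot_space_vectorspace coset_module_hom)

subsection \<open>Complements\<close>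

text \<open>This is a complement of N/D in R/D, described by its preimage \<open>S\<close> in
  \<open>V\<close>. As R/D can have infinite dimension, \<open>S\<close> is taken maximal among the
  subspaces between \<open>D\<close> and \<open>R\<close> that meet \<open>N\<close> in
  \<open>D\<close>. An element \<open>r\<close> of \<open>R\<close> outside S + N would allow the
  larger subspace S + Kr.\<close>

lemma relative_complement_exists:
  assumes D: "subspace K D V" and N: "subspace K N V" and R: "subspace K R V"
    and DN: "D \<subseteq> N" and NR: "N \<subseteq> R"
  obtains S where "subspace K S V" "D \<subseteq> S" "S \<subseteq> R" "S \<inter> N = D"
    "\<And>r. r \<in> R \<Longrightarrow> \<exists>s\<in>S. \<exists>n\<in>N. r = s \<oplus>\<^bsub>V\<^esub> n"
proof -
  interpret vectorspace K V using subspaceD(1)[OF D] .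
  let ?\<A> = "{S. subspace K S V \<and> D \<subseteq> S \<and> S \<subseteq> R \<and> S \<inter> N = D}"
  have "\<exists>S\<in>?\<A>. \<forall>S'\<in>?\<A>. S \<subseteq> S' \<longrightarrow> S' = S"
  proof (rule subset_Zorn_nonempty)
    show "?\<A> \<noteq> {}" using D DN NR by auto
  next
    fix \<C> assume ne: "\<C> \<noteq> {}" and ch: "subset.chain ?\<A> \<C>"
    have C: "S \<in> ?\<A>" if "S \<in> \<C>" for S
      using ch that unfolding subset_chain_def by (meson subsetD)
    have chain: "S \<subseteq> S' \<or> S' \<subseteq> S" if "S \<in> \<C>" "S' \<in> \<C>" for S S'
      using ch that unfolding subset_chain_def by meson
    have sub: "subspace K S V" if "S \<in> \<C>" for S using C[OF that] by simp
    have "subspace K (\<Union>\<C>) V"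
    proof (rule subspaceI[OF vectorspace_axioms])
      show "\<Union>\<C> \<subseteq> carrier V" using sub subspaceD(2) by blast
      show "\<zero>\<^bsub>V\<^esub> \<in> \<Union>\<C>" using ne sub subspaceD(3) by blast
    next
      fix x y assume "x \<in> \<Union>\<C>" "y \<in> \<Union>\<C>"
      then obtain S S' where "S \<in> \<C>" "S' \<in> \<C>" "x \<in> S" "y \<in> S'" by blast
      then obtain T where T: "T \<in> \<C>" "x \<in> T" "y \<in> T" using chain by blast
      show "x \<oplus>\<^bsub>V\<^esub> y \<in> \<Union>\<C>" using subspaceD(4)[OF sub[OF T(1)] T(2,3)] T(1) by (rule UnionI[rotated])
    next
      fix c x assume c: "c \<in> carrier K" and "x \<in> \<Union>\<C>"
      then obtain T where T: "T \<in> \<C>" "x \<in> T" by blast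
      show "c \<odot>\<^bsub>V\<^esub> x \<in> \<Union>\<C>" using subspaceD(5)[OF sub[OF T(1)] c T(2)] T(1) by (rule UnionI[rotated])
    qed
    moreover have "\<Union>\<C> \<inter> N = D" "D \<subseteq> \<Union>\<C>" "\<Union>\<C> \<subseteq> R" using C ne by fast+
    ultimately show "\<Union>\<C> \<in> ?\<A>" by blast
  qed
  then obtain S where "S \<in> ?\<A>" and max': "\<forall>S'\<in>?\<A>. S \<subseteq> S' \<longrightarrow> S' = S" by (rule bexE)
  then have S: "subspace K S V" "D \<subseteq> S" "S \<subseteq> R" "S \<inter> N = D" by simp_all
  have max: "S' = S" if "subspace K S' V" "D \<subseteq> S'" "S' \<subseteq> R" "S' \<inter> N = D" "S \<subseteq> S'" for S'
    using max' that by simp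
  note sS = subspaceD[OF S(1)] and sN = subspaceD[OF N] and sR = subspaceD[OF R]
  have "\<exists>s\<in>S. \<exists>n\<in>N. r = s \<oplus>\<^bsub>V\<^esub> n" if r: "r \<in> R" for r
  proof (rule ccontr)
    assume no: "\<not> ?thesis"
    have rV: "r \<in> carrier V" using r sR by auto
    define S' where "S' = {s \<oplus>\<^bsub>V\<^esub> c \<odot>\<^bsub>V\<^esub> r | s c. s \<in> S \<and> c \<in> carrier K}"
    have S'I: "s \<oplus>\<^bsub>V\<^esub> c \<odot>\<^bsub>V\<^esub> r \<in> S'" if "s \<in> S" "c \<in> carrier K" for s c
      using that by (auto simp: S'_def)
    have "subspace K S' V"
    proof (rule subspaceI[OF vectorspace_axioms])
      show "S' \<subseteq> carrier V" using sS rV by (auto simp: S'_def)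
      show "\<zero>\<^bsub>V\<^esub> \<in> S'" using S'I[of "\<zero>\<^bsub>V\<^esub>" "\<zero>\<^bsub>K\<^esub>"] sS rV by simp
    next
      fix x y assume "x \<in> S'" "y \<in> S'"
      then obtain s c s' c' where *: "s \<in> S" "c \<in> carrier K" "s' \<in> S" "c' \<in> carrier K"
        "x = s \<oplus>\<^bsub>V\<^esub> c \<odot>\<^bsub>V\<^esub> r" "y = s' \<oplus>\<^bsub>V\<^esub> c' \<odot>\<^bsub>V\<^esub> r"
        by (auto simp: S'_def)
      then have "x \<oplus>\<^bsub>V\<^esub> y = (s \<oplus>\<^bsub>V\<^esub> s') \<oplus>\<^bsub>V\<^esub> (c \<oplus>\<^bsub>K\<^esub> c') \<odot>\<^bsub>V\<^esub> r"
        using rV sS(6) by (simp add: smult_l_distr M.a_ac)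
      then show "x \<oplus>\<^bsub>V\<^esub> y \<in> S'" using S'I * sS(4) by simp
    next
      fix a x assume a: "a \<in> carrier K" and "x \<in> S'"
      then obtain s c where *: "s \<in> S" "c \<in> carrier K" "x = s \<oplus>\<^bsub>V\<^esub> c \<odot>\<^bsub>V\<^esub> r"
        by (auto simp: S'_def)
      then have "a \<odot>\<^bsub>V\<^esub> x = a \<odot>\<^bsub>V\<^esub> s \<oplus>\<^bsub>V\<^esub> (a \<otimes>\<^bsub>K\<^esub> c) \<odot>\<^bsub>V\<^esub> r"
        using a rV sS(6) by (simp add: smult_r_distr smult_assoc1)
      then show "a \<odot>\<^bsub>V\<^esub> x \<in> S'" using S'I * sS(5) a by simp
    qed
    moreover have SS': "S \<subseteq> S'"
    proof
      fix s assume "s \<in> S"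
      then show "s \<in> S'" using S'I[of s "\<zero>\<^bsub>K\<^esub>"] rV sS(6) by simp
    qed
    moreover have "S' \<subseteq> R" using S(3) r sR(4,5) by (auto simp: S'_def)
    moreover have "S' \<inter> N \<subseteq> D"
    proof
      fix x assume "x \<in> S' \<inter> N"
      then obtain s c where x: "s \<in> S" "c \<in> carrier K" "x = s \<oplus>\<^bsub>V\<^esub> c \<odot>\<^bsub>V\<^esub> r" "x \<in> N"
        by (auto simp: S'_def)
      show "x \<in> D"
      proof (cases "c = \<zero>\<^bsub>K\<^esub>")
        case True
        then have "x = s" using x rV sS(6) by simp
        then show ?thesis using x S(4) by auto
      next
        \<comment> \<open>With \<open>c\<close> invertible, \<open>x = s + c r\<close> can be solved
          for \<open>r\<close>, which exhibits \<open>r\<close> in S + N against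
          \<open>no\<close>.\<close>
        case False
        then have i: "inv\<^bsub>K\<^esub> c \<in> carrier K" "inv\<^bsub>K\<^esub> c \<otimes>\<^bsub>K\<^esub> c = \<one>\<^bsub>K\<^esub>"
          using x(2) by (auto simp: field_Units)
        have sV: "s \<in> carrier V" using x sS(6) by simp
        have "r = inv\<^bsub>K\<^esub> c \<odot>\<^bsub>V\<^esub> (c \<odot>\<^bsub>V\<^esub> r)"
          using i x(2) rV by (simp add: smult_assoc1[symmetric])
        also have "c \<odot>\<^bsub>V\<^esub> r = \<ominus>\<^bsub>V\<^esub> s \<oplus>\<^bsub>V\<^esub> x"
          using x(2,3) sV rV by (simp add: M.a_assoc[symmetric] M.l_neg)
        also have "inv\<^bsub>K\<^esub> c \<odot>\<^bsub>V\<^esub> (\<ominus>\<^bsub>V\<^esub> s \<oplus>\<^bsub>V\<^esub> x) = inv\<^bsub>K\<^esub> c \<odot>\<^bsub>V\<^esub> (\<ominus>\<^bsub>V\<^esub> s) \<oplus>\<^bsub>V\<^esub> inv\<^bsub>K\<^esub> c \<odot>\<^bsub>V\<^esub> x"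
          using i x sV sN(6) by (simp add: smult_r_distr)
        finally have "r = inv\<^bsub>K\<^esub> c \<odot>\<^bsub>V\<^esub> (\<ominus>\<^bsub>V\<^esub> s) \<oplus>\<^bsub>V\<^esub> inv\<^bsub>K\<^esub> c \<odot>\<^bsub>V\<^esub> x" .
        then show ?thesis
          using no i x sS(5) sN(5) subspace_neg[OF S(1)] by blast
      qed
    qed
    ultimately have "S' = S" using S(2) DN by (intro max) auto
    moreover have "r \<in> S'" using S'I[of "\<zero>\<^bsub>V\<^esub>" "\<one>\<^bsub>K\<^esub>"] sS(3) rV by simp
    ultimately have "r = r \<oplus>\<^bsub>V\<^esub> \<zero>\<^bsub>V\<^esub>" "r \<in> S" using rV by auto
    then show False using no sN(3) by blast
  qed
  then show thesis using that S by blast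
qed

section \<open>Diassociative algebras\<close>

lemma bilinear_mapD:
  assumes "bilinear_map K U V W b" "u \<in> carrier U" "v \<in> carrier V"
  shows "b u v \<in> carrier W"
    and "u' \<in> carrier U \<Longrightarrow> b (u \<oplus>\<^bsub>U\<^esub> u') v = b u v \<oplus>\<^bsub>W\<^esub> b u' v"
    and "v' \<in> carrier V \<Longrightarrow> b u (v \<oplus>\<^bsub>V\<^esub> v') = b u v \<oplus>\<^bsub>W\<^esub> b u v'"
    and "c \<in> carrier K \<Longrightarrow> b (c \<odot>\<^bsub>U\<^esub> u) v = c \<odot>\<^bsub>W\<^esub> b u v"
    and "c \<in> carrier K \<Longrightarrow> b u (c \<odot>\<^bsub>V\<^esub> v) = c \<odot>\<^bsub>W\<^esub> b u v"
  using assms by (auto simp: bilinear_map_def module_hom_def)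

lemma bilinear_mapI:
  assumes "\<And>u v. \<lbrakk>u \<in> carrier U; v \<in> carrier V\<rbrakk> \<Longrightarrow> b u v \<in> carrier W"
    and "\<And>u u' v. \<lbrakk>u \<in> carrier U; u' \<in> carrier U; v \<in> carrier V\<rbrakk>
      \<Longrightarrow> b (u \<oplus>\<^bsub>U\<^esub> u') v = b u v \<oplus>\<^bsub>W\<^esub> b u' v"
    and "\<And>u v v'. \<lbrakk>u \<in> carrier U; v \<in> carrier V; v' \<in> carrier V\<rbrakk>
      \<Longrightarrow> b u (v \<oplus>\<^bsub>V\<^esub> v') = b u v \<oplus>\<^bsub>W\<^esub> b u v'"
    and "\<And>c u v. \<lbrakk>c \<in> carrier K; u \<in> carrier U; v \<in> carrier V\<rbrakk>
      \<Longrightarrow> b (c \<odot>\<^bsub>U\<^esub> u) v = c \<odot>\<^bsub>W\<^esub> b u v"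
    and "\<And>c u v. \<lbrakk>c \<in> carrier K; u \<in> carrier U; v \<in> carrier V\<rbrakk>
      \<Longrightarrow> b u (c \<odot>\<^bsub>V\<^esub> v) = c \<odot>\<^bsub>W\<^esub> b u v"
  shows "bilinear_map K U V W b"
  using assms by (simp add: bilinear_map_def module_hom_def)

lemma bilinear_map_linear:
  assumes "bilinear_map K U V W b" "vectorspace K U" "vectorspace K V" "vectorspace K W"
  shows "u \<in> carrier U \<Longrightarrow> linear_map K V W (b u)"
    and "v \<in> carrier V \<Longrightarrow> linear_map K U W (\<lambda>u. b u v)"
  using assms by (auto simp: bilinear_map_def intro: linear_mapI)

lemma bilinear_map_flip: "bilinear_map K U V W b \<Longrightarrow> bilinear_map K V U W (\<lambda>v u. b u v)"
  by (simp add: bilinear_map_def)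

lemma bilinear_map_zero:
  assumes "bilinear_map K U V W b" "vectorspace K U" "vectorspace K V" "vectorspace K W"
  shows "u \<in> carrier U \<Longrightarrow> b u \<zero>\<^bsub>V\<^esub> = \<zero>\<^bsub>W\<^esub>"
    and "v \<in> carrier V \<Longrightarrow> b \<zero>\<^bsub>U\<^esub> v = \<zero>\<^bsub>W\<^esub>"
  using bilinear_map_linear[OF assms] linear_map_zero by blast+

lemma dialgebra_vectorspace: "diassociative_algebra K A \<Longrightarrow> vectorspace K A"
  by (simp add: diassociative_algebra_def)

subsection \<open>Spans of products\<close>

context diassociative_algebra
begin

lemmas dleft = bilinear_mapD[OF dleft_bilinear] bilinear_map_zero[OF dleft_bilinear vectorspace_axioms vectorspace_axioms vectorspace_axioms]
lemmas dright = bilinear_mapD[OF dright_bilinear] bilinear_map_zero[OF dright_bilinear vectorspace_axioms vectorspace_axioms vectorspace_axioms]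

text \<open>The sum of two spans is the span of the union. Inclusions of \<open>lozenge\<close> in a
  subspace thereby reduce to one set of generating products.\<close>

lemma lozenge_eq_span:
  assumes "X \<subseteq> carrier A" "Y \<subseteq> carrier A"
  shows "lozenge K A X Y
    = span ({x \<stileturn> y | x y. x \<in> X \<and> y \<in> Y} \<union> {x \<turnstile> y | x y. x \<in> X \<and> y \<in> Y})"
  unfolding lozenge_def dleft_span_def dright_span_def
  using assms dleft(1) dright(1) by (intro span_union_is_sum[symmetric]) blast+

lemma lozenge_subspace:
  assumes "X \<subseteq> carrier A" "Y \<subseteq> carrier A"
  shows "subspace K (lozenge K A X Y) A"
  unfolding lozenge_eq_span[OF assms]
  using assms dleft(1) dright(1) by (intro span_is_subspace) blast

lemma lozenge_mem:
  assumes "X \<subseteq> carrier A" "Y \<subseteq> carrier A" "x \<in> X" "y \<in> Y"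
  shows "x \<stileturn> y \<in> lozenge K A X Y" "x \<turnstile> y \<in> lozenge K A X Y"
proof -
  let ?S = "{x \<stileturn> y | x y. x \<in> X \<and> y \<in> Y} \<union> {x \<turnstile> y | x y. x \<in> X \<and> y \<in> Y}"
  have "?S \<subseteq> carrier A" using assms(1,2) dleft(1) dright(1) by blast
  then have "?S \<subseteq> lozenge K A X Y"
    unfolding lozenge_eq_span[OF assms(1,2)] by (rule in_own_span)
  then show "x \<stileturn> y \<in> lozenge K A X Y" "x \<turnstile> y \<in> lozenge K A X Y"
    using assms(3,4) by blast+
qed

lemma lozenge_least:
  assumes "X \<subseteq> carrier A" "Y \<subseteq> carrier A" "subspace K N A"
    and "\<And>x y. \<lbrakk>x \<in> X; y \<in> Y\<rbrakk> \<Longrightarrow> x \<stileturn> y \<in> N \<and> x \<turnstile> y \<in> N"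
  shows "lozenge K A X Y \<subseteq> N"
  unfolding lozenge_eq_span[OF assms(1,2)]
  using assms(4) by (intro span_least[OF assms(3)]) blast

lemma derived_subspace: "subspace K (derived K A) A"
  unfolding derived_def by (rule lozenge_subspace) auto

lemma derived_mem:
  assumes "x \<in> carrier A" "y \<in> carrier A"
  shows "x \<stileturn> y \<in> derived K A" "x \<turnstile> y \<in> derived K A"
  unfolding derived_def using lozenge_mem[OF subset_refl subset_refl assms] by simp_all

lemma derived_least:
  assumes "subspace K N A"
    and "\<And>x y. \<lbrakk>x \<in> carrier A; y \<in> carrier A\<rbrakk> \<Longrightarrow> x \<stileturn> y \<in> N \<and> x \<turnstile> y \<in> N"
  shows "derived K A \<subseteq> N"
  unfolding derived_def using assms by (intro lozenge_least) auto

end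

section \<open>The subspace \<open>D\<^sub>R\<close> generated by products with
  \<open>R\<close>\<close>

lemma hopf_denom_subspace:
  assumes "diassociative_algebra K A" "R \<subseteq> carrier A"
  shows "subspace K (hopf_denom K A R) A"
proof -
  interpret diassociative_algebra K A by fact
  show ?thesis
    unfolding hopf_denom_def using assms(2) by (intro sum_is_subspace lozenge_subspace) auto
qed

lemma hopf_denom_mem:
  assumes A: "diassociative_algebra K A" and h: "R \<subseteq> carrier A" "x \<in> carrier A" "r \<in> R"
  shows "x \<stileturn>\<^bsub>A\<^esub> r \<in> hopf_denom K A R" "r \<stileturn>\<^bsub>A\<^esub> x \<in> hopf_denom K A R"
    "x \<turnstile>\<^bsub>A\<^esub> r \<in> hopf_denom K A R" "r \<turnstile>\<^bsub>A\<^esub> x \<in> hopf_denom K A R"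
proof -
  interpret diassociative_algebra K A by fact
  have s: "subspace K (lozenge K A (carrier A) R) A" "subspace K (lozenge K A R (carrier A)) A"
    using h by (auto intro: lozenge_subspace)
  have "lozenge K A (carrier A) R \<subseteq> hopf_denom K A R" "lozenge K A R (carrier A) \<subseteq> hopf_denom K A R"
    unfolding hopf_denom_def
    using in_sum_vs[OF s] in_sum_vs[OF s(2,1)] vsum_comm[OF s] by auto
  then show "x \<stileturn>\<^bsub>A\<^esub> r \<in> hopf_denom K A R" "r \<stileturn>\<^bsub>A\<^esub> x \<in> hopf_denom K A R"
    "x \<turnstile>\<^bsub>A\<^esub> r \<in> hopf_denom K A R" "r \<turnstile>\<^bsub>A\<^esub> x \<in> hopf_denom K A R"
    using lozenge_mem[OF subset_refl h(1,2,3)] lozenge_mem[OF h(1) subset_refl h(3,2)]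
    by auto
qed

lemma hopf_denom_least:
  assumes A: "diassociative_algebra K A" and h: "R \<subseteq> carrier A" "subspace K N A"
    "\<And>x r. \<lbrakk>x \<in> carrier A; r \<in> R\<rbrakk>
      \<Longrightarrow> x \<stileturn>\<^bsub>A\<^esub> r \<in> N \<and> r \<stileturn>\<^bsub>A\<^esub> x \<in> N \<and> x \<turnstile>\<^bsub>A\<^esub> r \<in> N \<and> r \<turnstile>\<^bsub>A\<^esub> x \<in> N"
  shows "hopf_denom K A R \<subseteq> N"
proof -
  interpret diassociative_algebra K A by fact
  have s: "subspace K (lozenge K A (carrier A) R) A" "subspace K (lozenge K A R (carrier A)) A"
    using h by (auto intro: lozenge_subspace)
  show ?thesis unfolding hopf_denom_def vsum_is_minimal[OF s h(2)]
    using h by (intro conjI lozenge_least) auto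
qed

lemma ideal_hopf_denom:
  assumes A: "diassociative_algebra K A" and I: "dialg_ideal K A R"
  shows "hopf_denom K A R \<subseteq> R \<inter> derived K A"
proof -
  interpret diassociative_algebra K A by fact
  have R: "subspace K R A" using I by (simp add: dialg_ideal_def)
  show ?thesis
    using I subspaceD(6)[OF R] derived_mem
    by (intro hopf_denom_least[OF A] subspace_Int R derived_subspace subspaceD(2)[OF R])
      (auto simp: dialg_ideal_def)
qed

subsection \<open>Homomorphisms and quotients\<close>

lemma dialg_homD:
  assumes "h \<in> dialg_hom K A B"
  shows "h \<in> module_hom K A B"
    and "\<lbrakk>x \<in> carrier A; y \<in> carrier A\<rbrakk> \<Longrightarrow> h (x \<stileturn>\<^bsub>A\<^esub> y) = h x \<stileturn>\<^bsub>B\<^esub> h y"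
    and "\<lbrakk>x \<in> carrier A; y \<in> carrier A\<rbrakk> \<Longrightarrow> h (x \<turnstile>\<^bsub>A\<^esub> y) = h x \<turnstile>\<^bsub>B\<^esub> h y"
  using assms by (auto simp: dialg_hom_def)

lemma dialg_hom_linear:
  assumes "h \<in> dialg_hom K A B" "diassociative_algebra K A" "diassociative_algebra K B"
  shows "linear_map K A B h"
  using assms by (intro linear_mapI dialgebra_vectorspace dialg_homD)

lemma dialg_hom_compose:
  assumes "h \<in> dialg_hom K A B" "g \<in> dialg_hom K B C"
  shows "(\<lambda>x. g (h x)) \<in> dialg_hom K A C"
  using assms by (auto simp: dialg_hom_def module_hom_def Pi_def)

text \<open>The transfer principle for vector spaces, extended to the products: bilinearity and the
  five laws are identities, and identities pass to surjective images. It serves both for quotient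
  algebras and for copies of an algebra along an injection.\<close>

lemma dialgebra_surj_image:
  assumes A: "diassociative_algebra K A" and q: "q \<in> dialg_hom K A B"
    and surj: "q ` carrier A = carrier B" and zero: "q \<zero>\<^bsub>A\<^esub> = \<zero>\<^bsub>B\<^esub>"
  shows "diassociative_algebra K B"
proof -
  interpret A: diassociative_algebra K A by fact
  have vs: "vectorspace K B"
    using A.vectorspace_axioms dialg_homD(1)[OF q] surj zero by (rule vectorspace_surj_image)
  have ex: "\<exists>x\<in>carrier A. v = q x" if "v \<in> carrier B" for v using that surj by blast
  have in': "q x \<in> carrier B" if "x \<in> carrier A" for x using that surj by blast
  have add: "q x \<oplus>\<^bsub>B\<^esub> q y = q (x \<oplus>\<^bsub>A\<^esub> y)" if "x \<in> carrier A" "y \<in> carrier A" for x y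
    using dialg_homD(1)[OF q] that by (simp add: module_hom_add)
  have smult: "c \<odot>\<^bsub>B\<^esub> q x = q (c \<odot>\<^bsub>A\<^esub> x)" if "c \<in> carrier K" "x \<in> carrier A" for c x
    using dialg_homD(1)[OF q] that by (simp add: module_hom_smult)
  have l: "q x \<stileturn>\<^bsub>B\<^esub> q y = q (x \<stileturn>\<^bsub>A\<^esub> y)" and r: "q x \<turnstile>\<^bsub>B\<^esub> q y = q (x \<turnstile>\<^bsub>A\<^esub> y)"
    if "x \<in> carrier A" "y \<in> carrier A" for x y
    using dialg_homD(2,3)[OF q] that by simp_all
  note s = add smult l r A.dleft(1-5) A.dright(1-5) in'
  show ?thesis
  proof (intro diassociative_algebra.intro diassociative_algebra_axioms.intro vs)
    show "bilinear_map K B B B (dleft B)" "bilinear_map K B B B (dright B)"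
      by (rule bilinear_mapI; (drule ex)+; auto simp: s)+
  qed (drule ex; drule ex; drule ex; auto simp: s A.dleft_assoc A.dright_assoc A.dleft_dright
      A.dright_dleft_assoc A.dleft_dright'; fail)+
qed

lemma dialg_hom_factor:
  assumes A: "diassociative_algebra K A" and Q: "diassociative_algebra K Q" and B: "diassociative_algebra K B"
    and q: "q \<in> dialg_hom K A Q" "q ` carrier A = carrier Q" and f: "f \<in> dialg_hom K A B"
    and ker: "\<And>x. \<lbrakk>x \<in> carrier A; q x = \<zero>\<^bsub>Q\<^esub>\<rbrakk> \<Longrightarrow> f x = \<zero>\<^bsub>B\<^esub>"
  obtains g where "g \<in> dialg_hom K Q B" "\<And>x. x \<in> carrier A \<Longrightarrow> g (q x) = f x"
proof -
  interpret A: diassociative_algebra K A by fact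
  obtain g where g: "linear_map K Q B g" "\<And>x. x \<in> carrier A \<Longrightarrow> g (q x) = f x"
    using linear_map_factor[OF dialg_hom_linear[OF q(1) A Q] q(2) dialg_hom_linear[OF f A B]] ker
    by metis
  have ex: "\<exists>x\<in>carrier A. v = q x" if "v \<in> carrier Q" for v using that q(2) by blast
  have "g (x \<stileturn>\<^bsub>Q\<^esub> y) = g x \<stileturn>\<^bsub>B\<^esub> g y \<and> g (x \<turnstile>\<^bsub>Q\<^esub> y) = g x \<turnstile>\<^bsub>B\<^esub> g y"
    if "x \<in> carrier Q" "y \<in> carrier Q" for x y
    using that by (auto dest!: ex simp: g(2) dialg_homD(2,3)[OF q(1), symmetric]
        dialg_homD(2,3)[OF f] A.dleft(1) A.dright(1))
  then have "g \<in> dialg_hom K Q B"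
    using linear_mapD(3)[OF g(1)] by (simp add: dialg_hom_def)
  then show thesis using g(2) that by blast
qed

text \<open>A symmetric form of the first isomorphism theorem: each of the two maps factors through
  the other. It is meant for a surjection \<open>P \<rightarrow> L\<close> with kernel
  \<open>M\<close> and the coset map of \<open>P/M\<close>.\<close>

lemma dialg_isomorphic_same_kernel:
  assumes A: "diassociative_algebra K A" and B: "diassociative_algebra K B" and C: "diassociative_algebra K C"
    and f: "f \<in> dialg_hom K A B" "f ` carrier A = carrier B"
    and g: "g \<in> dialg_hom K A C" "g ` carrier A = carrier C"
    and ker: "\<And>x. x \<in> carrier A \<Longrightarrow> f x = \<zero>\<^bsub>B\<^esub> \<longleftrightarrow> g x = \<zero>\<^bsub>C\<^esub>"
  shows "dialg_isomorphic K B C"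
proof -
  obtain h where h: "h \<in> dialg_hom K B C" "\<And>x. x \<in> carrier A \<Longrightarrow> h (f x) = g x"
    using dialg_hom_factor[OF A B C f g(1)] ker by metis
  interpret F: linear_map K A B f using dialg_hom_linear[OF f(1) A B] .
  have "bij_betw h (carrier B) (carrier C)"
  proof (rule bij_betw_of_kernel[OF dialg_hom_linear[OF h(1) B C]])
    show "h ` carrier B = carrier C"
      unfolding f(2)[symmetric] g(2)[symmetric] by (auto simp: h(2) image_image)
  next
    fix y assume "y \<in> carrier B" "h y = \<zero>\<^bsub>C\<^esub>"
    then obtain x where x: "x \<in> carrier A" "y = f x" using f(2) by blast
    then show "y = \<zero>\<^bsub>B\<^esub>" using \<open>h y = \<zero>\<^bsub>C\<^esub>\<close> h(2) ker by simp
  qed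
  then show ?thesis using h(1) by (auto simp: dialg_isomorphic_def)
qed

lemma dialg_hom_inv:
  assumes A: "diassociative_algebra K A" and B: "diassociative_algebra K B"
    and h: "h \<in> dialg_hom K A B" "bij_betw h (carrier A) (carrier B)"
  obtains g where "g \<in> dialg_hom K B A" "\<And>x. x \<in> carrier A \<Longrightarrow> g (h x) = x"
proof -
  interpret linear_map K A B h using dialg_hom_linear[OF h(1) A B] .
  have inj: "inj_on h (carrier A)" and surj: "h ` carrier A = carrier B"
    using h(2) by (auto simp: bij_betw_def)
  have "(\<lambda>x. x) \<in> dialg_hom K A A" by (simp add: dialg_hom_def module_hom_def)
  moreover have "x = \<zero>\<^bsub>A\<^esub>" if "x \<in> carrier A" "h x = \<zero>\<^bsub>B\<^esub>" for x
    using that inj T0_is_0 V.module.M.zero_closed by (metis inj_onD)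
  ultimately show thesis
    using dialg_hom_factor[OF A B A h(1) surj] that by metis
qed

lemma image_derived:
  assumes A: "diassociative_algebra K A" and B: "diassociative_algebra K B"
    and h: "h \<in> dialg_hom K A B" "h ` carrier A = carrier B"
  shows "h ` derived K A = derived K B"
proof
  interpret A: diassociative_algebra K A by fact
  interpret B: diassociative_algebra K B by fact
  interpret linear_map K A B h using dialg_hom_linear[OF h(1) A B] .
  have lin: "linear_map K A B h" using dialg_hom_linear[OF h(1) A B] .
  have "derived K A \<subseteq> {x \<in> carrier A. h x \<in> derived K B}"
    by (intro A.derived_least subspace_preimage[OF lin] B.derived_subspace)
      (auto simp: A.dleft(1) A.dright(1) dialg_homD(2,3)[OF h(1)] B.derived_mem)
  then show "h ` derived K A \<subseteq> derived K B" by blast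
  show "derived K B \<subseteq> h ` derived K A"
  proof (intro B.derived_least subspace_image[OF lin] A.derived_subspace)
    fix x y assume "x \<in> carrier B" "y \<in> carrier B"
    then obtain a b where "a \<in> carrier A" "b \<in> carrier A" "x = h a" "y = h b"
      using h(2) by blast
    then show "x \<stileturn>\<^bsub>B\<^esub> y \<in> h ` derived K A \<and> x \<turnstile>\<^bsub>B\<^esub> y \<in> h ` derived K A"
      using A.derived_mem by (simp add: dialg_homD(2,3)[OF h(1), symmetric])
  qed
qed

lemma ideal_preimage:
  assumes A: "diassociative_algebra K A" and B: "diassociative_algebra K B"
    and h: "h \<in> dialg_hom K A B" and I: "dialg_ideal K B I"
  shows "dialg_ideal K A {x \<in> carrier A. h x \<in> I}"
proof -
  interpret A: diassociative_algebra K A by fact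
  have lin: "linear_map K A B h" using dialg_hom_linear[OF h A B] .
  have "h x \<in> carrier B" if "x \<in> carrier A" for x
    using that module_hom_in[OF dialg_homD(1)[OF h]] by blast
  then show ?thesis
    using I subspace_preimage[OF lin]
    by (auto simp: dialg_ideal_def A.dleft(1) A.dright(1) dialg_homD(2,3)[OF h])
qed

lemma ideal_zero:
  assumes "diassociative_algebra K A" shows "dialg_ideal K A {\<zero>\<^bsub>A\<^esub>}"
proof -
  interpret diassociative_algebra K A by fact
  show ?thesis
    using subspace_zero[OF vectorspace_axioms] dleft(6,7) dright(6,7) by (simp add: dialg_ideal_def)
qed

lemma quot_dialgebra_sel [simp]:
  "carrier (quot_dialgebra A I) = (\<lambda>x. I +>\<^bsub>A\<^esub> x) ` carrier A"
  "zero (quot_dialgebra A I) = I"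
  "add (quot_dialgebra A I) = set_add A"
  "smult (quot_dialgebra A I) = smult (quot_space A I)"
  by (auto simp: quot_dialgebra_def quot_space_def module.defs dialgebra.defs A_RCOSETS_def')

text \<open>The products of a quotient algebra are unions over all pairs of representatives, so the
  point is that every pair yields the same coset. For \<open>i\<close>, \<open>j\<close> in
  \<open>I\<close> one has (i + x)(j + y) = i(j + y) + (xj + xy), and the first two terms lie in the
  ideal. Here \<open>op\<close> stands for either product.\<close>

lemma coset_dialg_hom:
  assumes A: "diassociative_algebra K A" and I: "dialg_ideal K A I"
  shows "(\<lambda>x. I +>\<^bsub>A\<^esub> x) \<in> dialg_hom K A (quot_dialgebra A I)"
proof -
  interpret diassociative_algebra K A by fact
  have sub: "subspace K I A" using I by (simp add: dialg_ideal_def)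
  note s = subspaceD[OF sub]
  have self: "x \<in> I +>\<^bsub>A\<^esub> x" if "x \<in> carrier A" for x
    using that s(3) by (force simp: mem_coset_iff)
  have reduce: "I +>\<^bsub>A\<^esub> op x' y' = I +>\<^bsub>A\<^esub> op x y"
    if op: "bilinear_map K A A A op" and id: "\<And>x i. \<lbrakk>x \<in> carrier A; i \<in> I\<rbrakk> \<Longrightarrow> op x i \<in> I \<and> op i x \<in> I"
      and xy: "x \<in> carrier A" "y \<in> carrier A" "x' \<in> I +>\<^bsub>A\<^esub> x" "y' \<in> I +>\<^bsub>A\<^esub> y"
    for op x y x' y'
  proof -
    obtain i j where ij: "i \<in> I" "j \<in> I" "x' = i \<oplus>\<^bsub>A\<^esub> x" "y' = j \<oplus>\<^bsub>A\<^esub> y"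
      using xy by (auto simp: mem_coset_iff)
    have c: "i \<in> carrier A" "j \<in> carrier A" using ij s(6) by auto
    have "op x' y' = op i y' \<oplus>\<^bsub>A\<^esub> (op x j \<oplus>\<^bsub>A\<^esub> op x y)"
      using ij c xy by (simp add: bilinear_mapD[OF op] M.a_ac)
    moreover have "y' \<in> carrier A" using ij c xy by simp
    then have "op i y' \<in> I" "op x j \<in> I" "op x y \<in> carrier A" "op x j \<in> carrier A"
      using id[OF _ ij(1)] id[OF xy(1) ij(2)] xy c by (auto simp: bilinear_mapD[OF op])
    ultimately show ?thesis
      by (simp add: coset_add_subspace[OF sub])
  qed
  have prod: "(\<Union>x'\<in>I +>\<^bsub>A\<^esub> x. \<Union>y'\<in>I +>\<^bsub>A\<^esub> y. I +>\<^bsub>A\<^esub> op x' y') = I +>\<^bsub>A\<^esub> op x y"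
    if op: "bilinear_map K A A A op" and id: "\<And>x i. \<lbrakk>x \<in> carrier A; i \<in> I\<rbrakk> \<Longrightarrow> op x i \<in> I \<and> op i x \<in> I"
      and xy: "x \<in> carrier A" "y \<in> carrier A"
    for op x y
  proof -
    have "(\<Union>x'\<in>I +>\<^bsub>A\<^esub> x. \<Union>y'\<in>I +>\<^bsub>A\<^esub> y. I +>\<^bsub>A\<^esub> op x' y')
      = (\<Union>x'\<in>I +>\<^bsub>A\<^esub> x. \<Union>y'\<in>I +>\<^bsub>A\<^esub> y. I +>\<^bsub>A\<^esub> op x y)"
      by (intro SUP_cong refl reduce[OF op id xy])
    \<comment> \<open>The cosets are nonempty, so the union of a constant family over them is that
      constant.\<close>
    also have "\<dots> = I +>\<^bsub>A\<^esub> op x y"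
      using self[OF xy(1)] self[OF xy(2)] by (auto simp del: UN_simps)
    finally show ?thesis .
  qed
  show ?thesis
    using coset_module_hom[OF sub] prod[OF dleft_bilinear] prod[OF dright_bilinear] I
    by (auto simp: dialg_hom_def module_hom_def dialg_ideal_def quot_dialgebra_def quot_space_def
        module.defs dialgebra.defs A_RCOSETS_def')
qed

lemma quot_dialgebra:
  assumes A: "diassociative_algebra K A" and I: "dialg_ideal K A I"
  shows "diassociative_algebra K (quot_dialgebra A I)"
proof (rule dialgebra_surj_image[OF A coset_dialg_hom[OF A I]])
  interpret diassociative_algebra K A by fact
  have sub: "subspace K I A" using I by (simp add: dialg_ideal_def)
  show "I +>\<^bsub>A\<^esub> \<zero>\<^bsub>A\<^esub> = \<zero>\<^bsub>quot_dialgebra A I\<^esub>"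
    using subspaceD(3)[OF sub] by (simp add: coset_eq_zero_iff[OF sub])
qed simp

subsection \<open>Transport of structure\<close>

text \<open>Moves an algebra to another element type, so that a universal property restricted to
  algebras over \<open>'c\<close> can be applied to a copy of it.\<close>

lemma dialgebra_transport:
  fixes A :: "('k, 'a) dialgebra" and s :: "'a \<Rightarrow> 'c"
  assumes A: "diassociative_algebra K A" and s: "inj_on s (carrier A)"
  obtains B :: "('k, 'c) dialgebra" where "diassociative_algebra K B" "s \<in> dialg_hom K A B"
    "s ` carrier A = carrier B"
proof -
  interpret diassociative_algebra K A by fact
  define t where "t = inv_into (carrier A) s"
  have t: "t (s x) = x" if "x \<in> carrier A" for x using that s by (simp add: t_def)
  define B :: "('k, 'c) dialgebra" where "B = \<lparr>carrier = s ` carrier A, mult = (\<lambda>_ _. s \<zero>\<^bsub>A\<^esub>),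
    one = s \<zero>\<^bsub>A\<^esub>, zero = s \<zero>\<^bsub>A\<^esub>, add = (\<lambda>x y. s (t x \<oplus>\<^bsub>A\<^esub> t y)),
    smult = (\<lambda>c x. s (c \<odot>\<^bsub>A\<^esub> t x)),
    dleft = (\<lambda>x y. s (t x \<stileturn>\<^bsub>A\<^esub> t y)), dright = (\<lambda>x y. s (t x \<turnstile>\<^bsub>A\<^esub> t y))\<rparr>"
  have hom: "s \<in> dialg_hom K A B"
    by (auto simp: dialg_hom_def module_hom_def B_def t)
  have surj: "s ` carrier A = carrier B" by (simp add: B_def)
  moreover have "diassociative_algebra K B"
    by (rule dialgebra_surj_image[OF A hom surj]) (simp add: B_def)
  ultimately show thesis using hom that by blast
qed

section \<open>The multiplier\<close>

lemma (in abelian_group) add_minus_cancel: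
  assumes "x \<in> carrier G" "y \<in> carrier G" shows "y \<oplus> (x \<ominus> y) = x"
  using assms by (simp add: a_minus_def a_lcomm r_neg)

text \<open>Sets independent in \<open>W\<close> are independent in \<open>V\<close>, which bounds
  their size by the dimension of \<open>V\<close>. A maximal one exists and is a finite basis of
  \<open>W\<close>.\<close>

lemma fin_dim_subspace:
  assumes "vectorspace.fin_dim K V" "subspace K W V"
  shows "vectorspace.fin_dim K (V\<lparr>carrier := W\<rparr>)"
proof -
  interpret V: vectorspace K V using subspaceD(1)[OF assms(2)] .
  interpret W: vectorspace K "V\<lparr>carrier := W\<rparr>" using subspace_vectorspace[OF assms(2)] .
  have sub: "submodule K W V" using assms(2) by (simp add: subspace_def)
  let ?P = "\<lambda>S. S \<subseteq> carrier (V\<lparr>carrier := W\<rparr>) \<and> W.lin_indpt S"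
  have bound: "finite S \<and> card S \<le> V.dim" if "?P S" for S
  proof -
    have "S \<subseteq> W" using that by simp
    moreover have "V.lin_indpt S"
      using that V.span_li_not_depend(2)[OF \<open>S \<subseteq> W\<close> sub] by simp
    ultimately show ?thesis
      using V.li_le_dim[OF assms(1)] subspaceD(2)[OF assms(2)] by (meson subset_trans)
  qed
  have empty: "?P {}" by (simp add: W.lin_dep_def)
  have "\<exists>S. finite S \<and> maximal S ?P"
    by (rule maximal_exists[of ?P, OF _ empty]) (rule bound)
  then obtain S where S: "finite S" "maximal S ?P" by (elim exE conjE)
  then have "W.basis S" using W.max_li_is_basis by blast
  then show ?thesis using S(1) unfolding W.fin_dim_def W.basis_def by blast
qed

text \<open>Finite dimension is assumed of the target but must be shown for the source, and images
  inherit it from sources; hence the passage to the inverse map.\<close>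

lemma dim_linear_bij:
  assumes "linear_map K V W h" "bij_betw h (carrier V) (carrier W)" "vectorspace.fin_dim K W"
  shows "vectorspace.fin_dim K V" "vectorspace.dim K V = vectorspace.dim K W"
proof -
  have inv: "linear_map K W V (inv_into (carrier V) h)" by (rule linear_map_inv[OF assms(1,2)])
  have bij: "bij_betw (inv_into (carrier V) h) (carrier W) (carrier V)"
    using assms(2) by (rule bij_betw_inv_into)
  show "vectorspace.fin_dim K V"
    using bij by (intro linear_map_dim(1)[OF inv _ assms(3)]) (simp add: bij_betw_def)
  show "vectorspace.dim K V = vectorspace.dim K W"
    using linear_map.dim_eq[OF inv assms(3)] bij by (simp add: bij_betw_def)
qed

text \<open>One argument at a time: first the left factor runs through the span while the right one
  stays in \<open>S\<close>, then the right factor follows. At each stage the admissible elements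
  form a preimage of \<open>N\<close> under a linear map.\<close>

lemma bilinear_span:
  assumes V: "vectorspace K V" and b: "bilinear_map K V V V b" and S: "S \<subseteq> carrier V"
    and N: "subspace K N V" and prod: "\<And>x y. \<lbrakk>x \<in> S; y \<in> S\<rbrakk> \<Longrightarrow> b x y \<in> N"
    and x: "x \<in> module.span K V S" and y: "y \<in> module.span K V S"
  shows "b x y \<in> N"
proof -
  interpret vectorspace K V by fact
  have left: "span S \<subseteq> {x \<in> carrier V. b x z \<in> N}" if "z \<in> S" for z
    using that S prod
    by (intro span_least subspace_preimage[OF bilinear_map_linear(2)[OF b V V V]] N) auto
  have "span S \<subseteq> {z \<in> carrier V. b x z \<in> N}"
    using S x left span_is_subset2[OF S]
    by (intro span_least subspace_preimage[OF bilinear_map_linear(1)[OF b V V V]] N) auto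
  then show ?thesis using y by blast
qed

text \<open>Central summands do not contribute to products.\<close>

lemma (in diassociative_algebra) derived_mod_center:
  assumes C: "C \<subseteq> carrier A" and N: "subspace K N A"
    and decomp: "\<And>x. x \<in> carrier A \<Longrightarrow> \<exists>c\<in>C. \<exists>m\<in>dialg_center A. x = c \<oplus> m"
    and prod: "\<And>x y. \<lbrakk>x \<in> C; y \<in> C\<rbrakk> \<Longrightarrow> x \<stileturn> y \<in> N \<and> x \<turnstile> y \<in> N"
  shows "derived K A \<subseteq> N"
proof (rule derived_least[OF N])
  fix x y assume "x \<in> carrier A" "y \<in> carrier A"
  then obtain c m c' m' where x: "c \<in> C" "m \<in> dialg_center A" "x = c \<oplus> m"
    and y: "c' \<in> C" "m' \<in> dialg_center A" "y = c' \<oplus> m'"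
    using decomp by meson
  have in': "c \<in> carrier A" "c' \<in> carrier A" "m \<in> carrier A" "m' \<in> carrier A"
    using x y C by (auto simp: dialg_center_def)
  have "x \<stileturn> y = c \<stileturn> c'" "x \<turnstile> y = c \<turnstile> c'"
    using x(2,3) y(2,3) in' by (simp_all add: dleft(1-3) dright(1-3) dialg_center_def)
  then show "x \<stileturn> y \<in> N \<and> x \<turnstile> y \<in> N" using prod x y by simp
qed

text \<open>Let \<open>S\<close> be a finite set of lifts of a spanning set of \<open>L\<close>.
  Every element of \<open>P\<close> is one of span(S) plus one of the kernel. Since the kernel is
  central, products only see the first parts, so the products \<open>E\<close> of pairs from
  \<open>S\<close> span a space containing \<open>P'\<close>. Since the kernel lies in
  \<open>P'\<close>, it is spanned as well, and \<open>S \<union> E\<close> spans all of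
  \<open>P\<close>.\<close>

lemma fin_dim_central_extension:
  assumes P: "diassociative_algebra K P" and L: "diassociative_algebra K L" "vectorspace.fin_dim K L"
    and \<rho>: "\<rho> \<in> dialg_hom K P L" "\<rho> ` carrier P = carrier L"
    and ker: "{x \<in> carrier P. \<rho> x = \<zero>\<^bsub>L\<^esub>} \<subseteq> dialg_center P \<inter> derived K P"
  shows "vectorspace.fin_dim K P"
proof -
  interpret P: diassociative_algebra K P by fact
  interpret L: diassociative_algebra K L by fact
  have lin: "linear_map K P L \<rho>" by (rule dialg_hom_linear[OF \<rho>(1) P L(1)])
  interpret linear_map K P L \<rho> by (rule lin)
  obtain B where B: "finite B" "B \<subseteq> carrier L" "L.span B = carrier L"
    using L(2) unfolding L.fin_dim_def by blast
  obtain S where S: "S \<subseteq> carrier P" "finite S" "\<rho> ` S = B"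
    using finite_subset_image[of B \<rho> "carrier P"] B \<rho>(2) by metis
  define E where "E = (\<lambda>(x, y). x \<stileturn>\<^bsub>P\<^esub> y) ` (S \<times> S) \<union> (\<lambda>(x, y). x \<turnstile>\<^bsub>P\<^esub> y) ` (S \<times> S)"
  have E: "finite E" "E \<subseteq> carrier P"
    using S by (auto simp: E_def intro!: P.dleft(1) P.dright(1))
  have SE: "S \<union> E \<subseteq> carrier P" using S E by simp
  let ?U = "P.span (S \<union> E)"
  have U: "subspace K ?U P" by (rule P.span_is_subspace[OF SE])
  have EU: "E \<subseteq> ?U" "S \<subseteq> ?U" using P.in_own_span[OF SE] by auto
  have C: "subspace K (P.span S) P" by (rule P.span_is_subspace[OF S(1)])
  have "carrier L \<subseteq> \<rho> ` P.span S"
    unfolding B(3)[symmetric] using P.in_own_span[OF S(1)] S(3)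
    by (intro span_least subspace_image[OF lin C]) blast
  have decomp: "\<exists>c\<in>P.span S. \<exists>m\<in>{x \<in> carrier P. \<rho> x = \<zero>\<^bsub>L\<^esub>}. x = c \<oplus>\<^bsub>P\<^esub> m"
    if x: "x \<in> carrier P" for x
  proof -
    obtain c where c: "c \<in> P.span S" "\<rho> c = \<rho> x"
      using \<open>carrier L \<subseteq> \<rho> ` P.span S\<close> x by force
    have cP: "c \<in> carrier P" using subspaceD(6)[OF C c(1)] .
    have "x = c \<oplus>\<^bsub>P\<^esub> (x \<ominus>\<^bsub>P\<^esub> c)"
      using x cP by (simp add: P.M.add_minus_cancel)
    moreover have "\<rho> (x \<ominus>\<^bsub>P\<^esub> c) = \<zero>\<^bsub>L\<^esub>"
      using c cP x by (intro linear_map_eq_diff[OF lin]) auto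
    ultimately show ?thesis using c x cP by (intro bexI[of _ c] bexI[of _ "x \<ominus>\<^bsub>P\<^esub> c"]) auto
  qed
  have der: "derived K P \<subseteq> ?U"
  proof (rule P.derived_mod_center[OF subspaceD(2)[OF C] U])
    fix x y assume xy: "x \<in> P.span S" "y \<in> P.span S"
    show "x \<stileturn>\<^bsub>P\<^esub> y \<in> ?U \<and> x \<turnstile>\<^bsub>P\<^esub> y \<in> ?U"
      using EU by (intro conjI bilinear_span[OF P.vectorspace_axioms P.dleft_bilinear S(1) U _ xy]
          bilinear_span[OF P.vectorspace_axioms P.dright_bilinear S(1) U _ xy]) (auto simp: E_def)
  qed (use decomp ker in blast)
  have "carrier P \<subseteq> ?U"
  proof
    fix x assume "x \<in> carrier P"
    then obtain c m where cm: "c \<in> P.span S" "m \<in> {x \<in> carrier P. \<rho> x = \<zero>\<^bsub>L\<^esub>}" "x = c \<oplus>\<^bsub>P\<^esub> m"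
      using decomp by meson
    have "c \<in> ?U" using cm(1) span_least[OF U EU(2)] by blast
    moreover have "m \<in> ?U" using cm(2) ker der by blast
    ultimately show "x \<in> ?U" unfolding cm(3) by (rule subspaceD(4)[OF U])
  qed
  then have "?U = carrier P" using subspaceD(2)[OF U] by blast
  then show ?thesis
    unfolding P.fin_dim_def using SE S(2) E(1) by (intro exI[of _ "S \<union> E"]) auto
qed

text \<open>The isomorphism of a defining pair runs from \<open>L\<close> to \<open>P/M\<close>.
  Lifting from \<open>F\<close> and rank-nullity need the opposite direction, a surjection of
  \<open>P\<close> onto \<open>L\<close> with kernel exactly \<open>M\<close>: the coset map
  followed by the inverse isomorphism.\<close>

lemma defining_pair_hom:
  assumes L: "diassociative_algebra K L" and pair: "defining_pair K L P M"
  obtains \<rho> where "\<rho> \<in> dialg_hom K P L" "\<rho> ` carrier P = carrier L"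
    "M = {x \<in> carrier P. \<rho> x = \<zero>\<^bsub>L\<^esub>}"
proof -
  have P: "diassociative_algebra K P" and M: "dialg_ideal K P M"
    and iso: "dialg_isomorphic K L (quot_dialgebra P M)"
    using pair by (simp_all add: defining_pair_def)
  have sM: "subspace K M P" using M by (simp add: dialg_ideal_def)
  interpret P: diassociative_algebra K P by fact
  interpret L: diassociative_algebra K L by fact
  let ?Q = "quot_dialgebra P M"
  have Q: "diassociative_algebra K ?Q" by (rule quot_dialgebra[OF P M])
  obtain h where h: "h \<in> dialg_hom K L ?Q" "bij_betw h (carrier L) (carrier ?Q)"
    using iso by (auto simp: dialg_isomorphic_def)
  obtain g where g: "g \<in> dialg_hom K ?Q L" "\<And>y. y \<in> carrier L \<Longrightarrow> g (h y) = y"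
    using dialg_hom_inv[OF L Q h] by metis
  have surj: "h ` carrier L = carrier ?Q" using h(2) by (simp add: bij_betw_def)
  have g0: "g M = \<zero>\<^bsub>L\<^esub>" and h0: "h \<zero>\<^bsub>L\<^esub> = M"
    using linear_map_zero[OF dialg_hom_linear[OF g(1) Q L]]
      linear_map_zero[OF dialg_hom_linear[OF h(1) L Q]] by simp_all
  let ?\<rho> = "\<lambda>x. g (M +>\<^bsub>P\<^esub> x)"
  have "?\<rho> \<in> dialg_hom K P L" by (rule dialg_hom_compose[OF coset_dialg_hom[OF P M] g(1)])
  moreover have "?\<rho> ` carrier P = carrier L"
  proof -
    have "?\<rho> ` carrier P = g ` carrier ?Q" by (simp add: image_image)
    also have "\<dots> = carrier L" unfolding surj[symmetric] image_image by (simp add: g(2))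
    finally show ?thesis .
  qed
  moreover have "?\<rho> x = \<zero>\<^bsub>L\<^esub> \<longleftrightarrow> x \<in> M" if x: "x \<in> carrier P" for x
  proof
    assume \<rho>0: "?\<rho> x = \<zero>\<^bsub>L\<^esub>"
    have "M +>\<^bsub>P\<^esub> x \<in> h ` carrier L" unfolding surj using x by simp
    then obtain y where y: "y \<in> carrier L" "M +>\<^bsub>P\<^esub> x = h y" by blast
    then have "y = \<zero>\<^bsub>L\<^esub>" using g(2) \<rho>0 by metis
    then show "x \<in> M" using y(2) h0 coset_eq_zero_iff[OF sM x] by simp
  next
    assume "x \<in> M"
    then show "?\<rho> x = \<zero>\<^bsub>L\<^esub>" using coset_eq_zero_iff[OF sM x] g0 by simp
  qed
  ultimately show thesis using subspaceD(2)[OF sM] by (intro that) auto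
qed

section \<open>Hopf quotients and maps out of them\<close>

lemma hopf_coset_linear:
  assumes F: "diassociative_algebra K F" and R: "dialg_ideal K F R"
  shows "linear_map K (F\<lparr>carrier := R \<inter> derived K F\<rparr>) (hopf_quotient K F R)
    (\<lambda>x. hopf_denom K F R +>\<^bsub>F\<^esub> x)"
proof -
  interpret F: diassociative_algebra K F by fact
  have sR: "subspace K R F" using R by (simp add: dialg_ideal_def)
  have "subspace K (hopf_denom K F R) (F\<lparr>carrier := R \<inter> derived K F\<rparr>)"
    using ideal_hopf_denom[OF F R]
    by (intro subspace_in_subspace hopf_denom_subspace[OF F] subspaceD(2)[OF sR] subspace_Int sR
        F.derived_subspace)
  from coset_linear_map[OF this] show ?thesis by (simp add: hopf_quotient_def)
qed

lemma hopf_quotient_sel [simp]: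
  "carrier (hopf_quotient K F R) = (\<lambda>x. hopf_denom K F R +>\<^bsub>F\<^esub> x) ` (R \<inter> derived K F)"
  "zero (hopf_quotient K F R) = hopf_denom K F R"
  by (simp_all add: hopf_quotient_def)

lemma hopf_coset_zero_iff:
  assumes F: "diassociative_algebra K F" and R: "R \<subseteq> carrier F" and x: "x \<in> carrier F"
  shows "hopf_denom K F R +>\<^bsub>F\<^esub> x = hopf_denom K F R \<longleftrightarrow> x \<in> hopf_denom K F R"
  using coset_eq_zero_iff[OF hopf_denom_subspace[OF F R] x] .


text \<open>The common source of all maps defined on a Hopf quotient: the comparison map onto the
  kernel of a competing pair, and the second and third map of the Ganea sequence.\<close>

lemma hopf_quotient_factor:
  assumes F: "diassociative_algebra K F" and R: "dialg_ideal K F R"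
    and f: "linear_map K (F\<lparr>carrier := R \<inter> derived K F\<rparr>) W f"
    and zero: "\<And>x. x \<in> hopf_denom K F R \<Longrightarrow> f x = \<zero>\<^bsub>W\<^esub>"
  obtains g where "linear_map K (hopf_quotient K F R) W g"
    "\<And>x. x \<in> R \<inter> derived K F \<Longrightarrow> g (hopf_denom K F R +>\<^bsub>F\<^esub> x) = f x"
proof (rule linear_map_factor[OF hopf_coset_linear[OF F R] _ f])
  have sR: "R \<subseteq> carrier F" using R by (auto simp: dialg_ideal_def dest: subspaceD)
  fix x assume "x \<in> carrier (F\<lparr>carrier := R \<inter> derived K F\<rparr>)"
    "hopf_denom K F R +>\<^bsub>F\<^esub> x = \<zero>\<^bsub>hopf_quotient K F R\<^esub>"
  then show "f x = \<zero>\<^bsub>W\<^esub>" using hopf_coset_zero_iff[OF F sR] sR zero by auto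
next
  fix g assume "linear_map K (hopf_quotient K F R) W g"
    "\<And>x. x \<in> carrier (F\<lparr>carrier := R \<inter> derived K F\<rparr>)
      \<Longrightarrow> g (hopf_denom K F R +>\<^bsub>F\<^esub> x) = f x"
  then show thesis using that by simp
qed simp

text \<open>The pair is \<open>(F/S, R/S)\<close>. It is built from the surjection
  \<open>\<pi>\<close> alone; lifting of homomorphisms becomes relevant only when this pair is
  compared with others.\<close>

lemma multiplier_cover:
  fixes K :: "'k ring" and L :: "('k, 'l) dialgebra" and F :: "('k, 'f) dialgebra"
  assumes L: "diassociative_algebra K L" and fin: "vectorspace.fin_dim K L"
    and F: "diassociative_algebra K F"
    and \<pi>: "\<pi> \<in> dialg_hom K F L" "\<pi> ` carrier F = carrier L"
    and R: "R = {x \<in> carrier F. \<pi> x = \<zero>\<^bsub>L\<^esub>}"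
  obtains P :: "('k, 'f set) dialgebra" and M and h
  where "defining_pair K L P M" "linear_map K (hopf_quotient K F R) (P\<lparr>carrier := M\<rparr>) h"
    "bij_betw h (carrier (hopf_quotient K F R)) M"
proof -
  interpret L: diassociative_algebra K L by fact
  interpret F: diassociative_algebra K F by fact
  let ?D = "hopf_denom K F R" and ?N = "R \<inter> derived K F" and ?H = "hopf_quotient K F R"
  have idR: "dialg_ideal K F R"
    using ideal_preimage[OF F L \<pi>(1) ideal_zero[OF L]] by (simp add: R)
  have sR: "subspace K R F" using idR by (simp add: dialg_ideal_def)
  note RF = subspaceD(2)[OF sR]
  have DN: "?D \<subseteq> ?N" by (rule ideal_hopf_denom[OF F idR])
  have sN: "subspace K ?N F" by (rule subspace_Int[OF sR F.derived_subspace])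
  obtain S where S: "subspace K S F" "?D \<subseteq> S" "S \<subseteq> R" "S \<inter> ?N = ?D"
    and RS: "\<And>r. r \<in> R \<Longrightarrow> \<exists>s\<in>S. \<exists>n\<in>?N. r = s \<oplus>\<^bsub>F\<^esub> n"
    using relative_complement_exists[OF hopf_denom_subspace[OF F RF] sN sR DN] by blast
  \<comment> \<open>This single fact has two consequences: \<open>S\<close> is an ideal, being
    contained in \<open>R\<close>, and \<open>R/S\<close> is central in \<open>F/S\<close>.\<close>
  have prodR: "x \<stileturn>\<^bsub>F\<^esub> r \<in> S \<and> r \<stileturn>\<^bsub>F\<^esub> x \<in> S \<and> x \<turnstile>\<^bsub>F\<^esub> r \<in> S \<and> r \<turnstile>\<^bsub>F\<^esub> x \<in> S"
    if "x \<in> carrier F" "r \<in> R" for x r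
    using hopf_denom_mem[OF F RF that] S(2) by blast
  have idS: "dialg_ideal K F S" unfolding dialg_ideal_def using S(1,3) prodR by blast
  define P where "P = quot_dialgebra F S"
  define q where "q x = S +>\<^bsub>F\<^esub> x" for x
  define M where "M = q ` R"
  have P: "diassociative_algebra K P" unfolding P_def by (rule quot_dialgebra[OF F idS])
  interpret P: diassociative_algebra K P by (rule P)
  have q: "q \<in> dialg_hom K F P" "q ` carrier F = carrier P"
    using coset_dialg_hom[OF F idS] by (simp_all add: P_def q_def[abs_def])
  have qlin: "linear_map K F P q" by (rule dialg_hom_linear[OF q(1) F P])
  interpret q: linear_map K F P q by (rule qlin)
  have q0: "q x = \<zero>\<^bsub>P\<^esub> \<longleftrightarrow> x \<in> S" if "x \<in> carrier F" for x
    using coset_eq_zero_iff[OF S(1) that] by (simp add: P_def q_def)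
  obtain \<rho> where \<rho>: "\<rho> \<in> dialg_hom K P L" "\<And>x. x \<in> carrier F \<Longrightarrow> \<rho> (q x) = \<pi> x"
    using dialg_hom_factor[OF F P L q \<pi>(1)] q0 S(3) R by blast
  have \<rho>surj: "\<rho> ` carrier P = carrier L"
    unfolding q(2)[symmetric] \<pi>(2)[symmetric] image_image by (simp add: \<rho>(2))
  have M: "M = {y \<in> carrier P. \<rho> y = \<zero>\<^bsub>L\<^esub>}"
    unfolding q(2)[symmetric] M_def R by (auto simp: \<rho>(2))
  have idM: "dialg_ideal K P M"
    using ideal_preimage[OF P L \<rho>(1) ideal_zero[OF L]] by (simp add: M)
  have sM: "subspace K M P" using idM by (simp add: dialg_ideal_def)
  have iso: "dialg_isomorphic K L (quot_dialgebra P M)"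
  proof (rule dialg_isomorphic_same_kernel[OF P L quot_dialgebra[OF P idM] \<rho>(1) \<rho>surj
        coset_dialg_hom[OF P idM]])
    show "\<rho> x = \<zero>\<^bsub>L\<^esub> \<longleftrightarrow> M +>\<^bsub>P\<^esub> x = \<zero>\<^bsub>quot_dialgebra P M\<^esub>" if "x \<in> carrier P" for x
      using coset_eq_zero_iff[OF sM that] that by (simp add: M)
  qed simp
  have "M \<subseteq> dialg_center P"
  proof
    fix y assume "y \<in> M"
    then obtain r where r: "r \<in> R" "y = q r" unfolding M_def by blast
    have rF: "r \<in> carrier F" using r RF by blast
    have "y \<stileturn>\<^bsub>P\<^esub> z = \<zero>\<^bsub>P\<^esub> \<and> z \<stileturn>\<^bsub>P\<^esub> y = \<zero>\<^bsub>P\<^esub> \<and> y \<turnstile>\<^bsub>P\<^esub> z = \<zero>\<^bsub>P\<^esub> \<and> z \<turnstile>\<^bsub>P\<^esub> y = \<zero>\<^bsub>P\<^esub>"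
      if "z \<in> carrier P" for z
    proof -
      obtain x where x: "x \<in> carrier F" "z = q x"
        using \<open>z \<in> carrier P\<close> unfolding q(2)[symmetric] by (rule imageE)
      have "y \<stileturn>\<^bsub>P\<^esub> z = q (r \<stileturn>\<^bsub>F\<^esub> x)" "z \<stileturn>\<^bsub>P\<^esub> y = q (x \<stileturn>\<^bsub>F\<^esub> r)"
        "y \<turnstile>\<^bsub>P\<^esub> z = q (r \<turnstile>\<^bsub>F\<^esub> x)" "z \<turnstile>\<^bsub>P\<^esub> y = q (x \<turnstile>\<^bsub>F\<^esub> r)"
        using dialg_homD(2,3)[OF q(1) rF x(1)] dialg_homD(2,3)[OF q(1) x(1) rF]
        by (simp_all only: r(2) x(2))
      then show ?thesis
        using prodR[OF x(1) r(1)] q0 F.dleft(1) F.dright(1) x(1) rF by simp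
    qed
    moreover have "y \<in> carrier P" unfolding r(2) using rF by (rule q.f_im)
    ultimately show "y \<in> dialg_center P" by (simp add: dialg_center_def)
  qed
  \<comment> \<open>Since \<open>R = S + ?N\<close> and \<open>q\<close> kills \<open>S\<close>, all
    of \<open>M\<close> already comes from \<open>?N\<close>. This places \<open>M\<close> in the
    derived algebra of \<open>P\<close> and later makes \<open>h\<close> surjective.\<close>
  moreover have qN: "q ` ?N = M"
  proof
    show "M \<subseteq> q ` ?N"
    proof
      fix y assume "y \<in> M"
      then obtain r where r: "r \<in> R" "y = q r" unfolding M_def by blast
      obtain s n where sn: "s \<in> S" "n \<in> ?N" "r = s \<oplus>\<^bsub>F\<^esub> n" using RS[OF r(1)] by blast
      have c: "s \<in> carrier F" "n \<in> carrier F"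
        using sn(1,2) subspaceD(6)[OF S(1)] subspaceD(6)[OF sN] by blast+
      have "q s = \<zero>\<^bsub>P\<^esub>" using q0 c sn(1) by blast
      then have "y = q n" using r(2) sn(3) c by simp
      then show "y \<in> q ` ?N" using sn(2) by blast
    qed
  qed (auto simp: M_def)
  moreover have "q ` ?N \<subseteq> derived K P" using image_derived[OF F P q] by blast
  ultimately have pair: "defining_pair K L P M"
    using P idM iso by (auto simp: defining_pair_def)
  have qres: "linear_map K (F\<lparr>carrier := ?N\<rparr>) (P\<lparr>carrier := M\<rparr>) q"
    using qN by (intro linear_map_restrict[OF qlin sN sM]) blast
  have "q x = \<zero>\<^bsub>P\<lparr>carrier := M\<rparr>\<^esub>" if "x \<in> ?D" for x
    using q0[OF subspaceD(6)[OF S(1)]] subsetD[OF S(2) that] by simp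
  then obtain h where h: "linear_map K ?H (P\<lparr>carrier := M\<rparr>) h"
    "\<And>x. x \<in> ?N \<Longrightarrow> h (?D +>\<^bsub>F\<^esub> x) = q x"
    using hopf_quotient_factor[OF F idR qres] by blast
  have "bij_betw h (carrier ?H) M"
  proof (rule bij_betw_of_kernel[OF h(1)])
    show "h ` carrier ?H = M" unfolding qN[symmetric] by (simp add: image_image h(2))
  next
    fix y assume "y \<in> carrier ?H" and hy: "h y = \<zero>\<^bsub>P\<lparr>carrier := M\<rparr>\<^esub>"
    then obtain x where x: "x \<in> ?N" "y = ?D +>\<^bsub>F\<^esub> x" by auto
    have xF: "x \<in> carrier F" using x(1) RF by blast
    \<comment> \<open>Injectivity of \<open>h\<close> rests on the choice of \<open>S\<close>: an
      element of \<open>?N\<close> killed by \<open>q\<close> lies in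
      \<open>S \<inter> ?N = ?D\<close>.\<close>
    have "x \<in> S" using hy h(2)[OF x(1)] q0[OF xF] x(2) by simp
    then have "x \<in> ?D" using x(1) S(4) by blast
    then show "y = \<zero>\<^bsub>?H\<^esub>" using x(2) hopf_coset_zero_iff[OF F RF xF] by simp
  qed
  then show thesis using that pair h(1) by blast
qed

text \<open>The universal property of \<open>F\<close> only concerns algebras over the type \<open>'c\<close>; the
  uniqueness of \<open>\<pi>\<close> is therefore read off from a copy of \<open>L\<close> inside \<open>P\<close>.\<close>

lemma free_lift:
  fixes K :: "'k ring" and L :: "('k, 'l) dialgebra" and P :: "('k, 'c) dialgebra"
  assumes F: "free_diassociative TYPE('c) K F X"
    and L: "diassociative_algebra K L" and P: "diassociative_algebra K P"
    and \<pi>: "\<pi> \<in> dialg_hom K F L" and \<rho>: "\<rho> \<in> dialg_hom K P L" "\<rho> ` carrier P = carrier L"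
  obtains h where "h \<in> dialg_hom K F P" "\<And>x. x \<in> carrier F \<Longrightarrow> \<rho> (h x) = \<pi> x"
proof -
  have XF: "X \<subseteq> carrier F" using F by (simp add: free_diassociative_def)
  have free: "\<exists>h\<in>dialg_hom K F A. (\<forall>x\<in>X. h x = g x) \<and>
      (\<forall>h'\<in>dialg_hom K F A. (\<forall>x\<in>X. h' x = g x) \<longrightarrow> (\<forall>y\<in>carrier F. h' y = h y))"
    if "diassociative_algebra K A" "g \<in> X \<rightarrow> carrier A" for A :: "('k, 'c) dialgebra" and g
    using F that by (simp add: free_diassociative_def)
  \<comment> \<open>An arbitrary set-theoretic section of \<open>\<rho>\<close>. It prescribes the
    values of the lift on the generators, and as an injection it carries the structure of
    \<open>L\<close> over to a subset of the type \<open>'c\<close>.\<close>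
  define s where "s = inv_into (carrier P) \<rho>"
  have s: "s y \<in> carrier P" "\<rho> (s y) = y" if "y \<in> carrier L" for y
    using that \<rho>(2) by (auto simp: s_def inv_into_into f_inv_into_f)
  then have inj: "inj_on s (carrier L)" by (intro inj_on_inverseI[of _ \<rho>])
  obtain C :: "('k, 'c) dialgebra" where C: "diassociative_algebra K C" "s \<in> dialg_hom K L C"
    by (rule dialgebra_transport[OF L inj]) (rule that)
  have \<pi>L: "\<pi> x \<in> carrier L" if "x \<in> carrier F" for x
    using module_hom_in[OF dialg_homD(1)[OF \<pi>] that] .
  have "(\<lambda>x. s (\<pi> x)) \<in> X \<rightarrow> carrier P" using s(1) \<pi>L XF by blast
  then obtain h where h: "h \<in> dialg_hom K F P" "\<forall>x\<in>X. h x = s (\<pi> x)"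
    using free[OF P] by blast
  have \<rho>L: "\<rho> (h x) \<in> carrier L" if "x \<in> carrier F" for x
    using that module_hom_in[OF dialg_homD(1)[OF h(1)]] module_hom_in[OF dialg_homD(1)[OF \<rho>(1)]]
    by blast
  \<comment> \<open>The section \<open>s\<close> is a homomorphism into the copy \<open>C\<close> of
    \<open>L\<close>, though generally not into \<open>P\<close>. So both
    \<open>s \<circ> \<rho> \<circ> h\<close> and \<open>s \<circ> \<pi>\<close> are homomorphisms
    into \<open>C\<close> that agree on \<open>X\<close>, and uniqueness identifies them.\<close>
  have hom: "(\<lambda>x. s (\<rho> (h x))) \<in> dialg_hom K F C" "(\<lambda>x. s (\<pi> x)) \<in> dialg_hom K F C"
    using dialg_hom_compose[OF dialg_hom_compose[OF h(1) \<rho>(1)] C(2)] dialg_hom_compose[OF \<pi> C(2)]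
    by simp_all
  have XC: "(\<lambda>x. s (\<pi> x)) \<in> X \<rightarrow> carrier C"
    using \<pi>L XF module_hom_in[OF dialg_homD(1)[OF C(2)]] by blast
  have agree: "\<forall>x\<in>X. s (\<rho> (h x)) = s (\<pi> x)"
    using h(2) s(2) \<pi>L XF by (metis subsetD)
  obtain u where u: "\<forall>h'\<in>dialg_hom K F C. (\<forall>x\<in>X. h' x = s (\<pi> x)) \<longrightarrow> (\<forall>y\<in>carrier F. h' y = u y)"
    using free[OF C(1) XC] by (elim bexE conjE) (rule that)
  have "s (\<rho> (h y)) = s (\<pi> y)" if "y \<in> carrier F" for y
    using mp[OF bspec[OF u hom(1)] agree] mp[OF bspec[OF u hom(2)]] that by simp
  then have "\<rho> (h x) = \<pi> x" if "x \<in> carrier F" for x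
    using that inj \<pi>L \<rho>L by (metis inj_onD)
  then show thesis using that h(1) by blast
qed

theorem hopf_formula:
  fixes K :: "'k ring" and L :: "('k, 'l) dialgebra" and F :: "('k, 'f) dialgebra"
  assumes L: "diassociative_algebra K L" and fin: "vectorspace.fin_dim K L"
    and F: "free_diassociative TYPE('c) K F X"
    and \<pi>: "\<pi> \<in> dialg_hom K F L" "\<pi> ` carrier F = carrier L"
    and R: "R = {x \<in> carrier F. \<pi> x = \<zero>\<^bsub>L\<^esub>}"
  shows "is_multiplier TYPE('c) K L (hopf_quotient K F R)"
proof -
  have dF: "diassociative_algebra K F" using F by (simp add: free_diassociative_def)
  interpret L: diassociative_algebra K L by fact
  interpret F: diassociative_algebra K F by (rule dF)
  let ?D = "hopf_denom K F R" and ?N = "R \<inter> derived K F" and ?H = "hopf_quotient K F R"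
  have idR: "dialg_ideal K F R"
    using ideal_preimage[OF dF L \<pi>(1) ideal_zero[OF L]] by (simp add: R)
  have sR: "subspace K R F" using idR by (simp add: dialg_ideal_def)
  note RF = subspaceD(2)[OF sR]
  have sN: "subspace K ?N F" by (rule subspace_Int[OF sR F.derived_subspace])
  \<comment> \<open>The element type of \<open>P\<close> is left open because two instances are
    needed: the pair constructed from \<open>F\<close> lives over \<open>'f set\<close>, its
    competitors over \<open>'c\<close>.\<close>
  have fin_dim_pair: "vectorspace.fin_dim K P \<and> vectorspace.fin_dim K (P\<lparr>carrier := M\<rparr>) \<and>
      vectorspace.dim K P = vectorspace.dim K L + vectorspace.dim K (P\<lparr>carrier := M\<rparr>)"
    if pair: "defining_pair K L P M" for P :: "('k, 'p) dialgebra" and M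
  proof -
    have P: "diassociative_algebra K P" and M: "subspace K M P" "M \<subseteq> dialg_center P \<inter> derived K P"
      using pair by (simp_all add: defining_pair_def dialg_ideal_def)
    obtain \<rho> where \<rho>: "\<rho> \<in> dialg_hom K P L" "\<rho> ` carrier P = carrier L"
      "M = {x \<in> carrier P. \<rho> x = \<zero>\<^bsub>L\<^esub>}"
      using defining_pair_hom[OF L pair] .
    have f: "vectorspace.fin_dim K P"
      using M(2) unfolding \<rho>(3) by (rule fin_dim_central_extension[OF P L fin \<rho>(1,2)])
    then show ?thesis
      using linear_map_dim(2)[OF dialg_hom_linear[OF \<rho>(1) P L] \<rho>(2) f] fin_dim_subspace[OF f M(1)]
      by (simp add: \<rho>(3))
  qed
  obtain P :: "('k, 'f set) dialgebra" and M h where PM: "defining_pair K L P M"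
    and h: "linear_map K ?H (P\<lparr>carrier := M\<rparr>) h" "bij_betw h (carrier ?H) M"
    using multiplier_cover[OF L fin dF \<pi> R] .
  note finP = fin_dim_pair[OF PM]
  \<comment> \<open>The space \<open>?N\<close> may have infinite dimension; its quotient
    \<open>?H\<close> is finite-dimensional because it is isomorphic to the kernel of a
    finite-dimensional pair.\<close>
  have H: "vectorspace.fin_dim K ?H" "vectorspace.dim K ?H = vectorspace.dim K (P\<lparr>carrier := M\<rparr>)"
    using dim_linear_bij[OF h(1)] h(2) finP by simp_all
  have "vectorspace.dim K P' \<le> vectorspace.dim K P"
    if pair: "defining_pair K L P' M'" for P' :: "('k, 'c) dialgebra" and M'
  proof -
    have P': "diassociative_algebra K P'" and M': "subspace K M' P'" "M' \<subseteq> dialg_center P'"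
      "M' \<subseteq> derived K P'"
      using pair by (simp_all add: defining_pair_def dialg_ideal_def)
    interpret P': diassociative_algebra K P' by (rule P')
    obtain \<rho> where \<rho>: "\<rho> \<in> dialg_hom K P' L" "\<rho> ` carrier P' = carrier L"
      and M'\<rho>: "M' = {x \<in> carrier P'. \<rho> x = \<zero>\<^bsub>L\<^esub>}"
      using defining_pair_hom[OF L pair] .
    obtain k where k: "k \<in> dialg_hom K F P'" and \<rho>k: "\<And>x. x \<in> carrier F \<Longrightarrow> \<rho> (k x) = \<pi> x"
      using free_lift[OF F L P' \<pi>(1) \<rho>] by blast
    have klin: "linear_map K F P' k" by (rule dialg_hom_linear[OF k dF P'])
    have \<rho>lin: "linear_map K P' L \<rho>" by (rule dialg_hom_linear[OF \<rho>(1) P' L])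
    interpret k: linear_map K F P' k by (rule klin)
    have kN: "k x \<in> M'" if "x \<in> R" for x using that R RF M'\<rho> \<rho>k by auto
    have "derived K P' \<subseteq> k ` derived K F"
    proof (rule P'.derived_mod_center[of "k ` carrier F"])
      show "subspace K (k ` derived K F) P'" by (rule subspace_image[OF klin F.derived_subspace])
    next
      \<comment> \<open>Choose \<open>f\<close> in \<open>F\<close> with the same image in
        \<open>L\<close> as \<open>x\<close>. Then \<open>x - k f\<close> is in the kernel of
        \<open>\<rho>\<close>, which is the central ideal \<open>M'\<close>.\<close>
      fix x assume x: "x \<in> carrier P'"
      then have "\<rho> x \<in> \<pi> ` carrier F" unfolding \<pi>(2) \<rho>(2)[symmetric] by blast
      then obtain f where f: "f \<in> carrier F" "\<rho> x = \<pi> f" by blast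
      have "\<rho> (x \<ominus>\<^bsub>P'\<^esub> k f) = \<zero>\<^bsub>L\<^esub>"
        using f x \<rho>k by (intro linear_map_eq_diff[OF \<rho>lin]) auto
      then have "x \<ominus>\<^bsub>P'\<^esub> k f \<in> dialg_center P'" using M'(2) M'\<rho> x f(1) by auto
      moreover have "x = k f \<oplus>\<^bsub>P'\<^esub> (x \<ominus>\<^bsub>P'\<^esub> k f)"
        using x f(1) by (simp add: P'.M.add_minus_cancel)
      ultimately show "\<exists>c\<in>k ` carrier F. \<exists>m\<in>dialg_center P'. x = c \<oplus>\<^bsub>P'\<^esub> m" using f(1) by blast
    next
      fix x y assume "x \<in> k ` carrier F" "y \<in> k ` carrier F"
      then show "x \<stileturn>\<^bsub>P'\<^esub> y \<in> k ` derived K F \<and> x \<turnstile>\<^bsub>P'\<^esub> y \<in> k ` derived K F"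
        using F.derived_mem by (auto simp: dialg_homD(2,3)[OF k, symmetric])
    qed auto
    have kM: "k ` ?N = M'"
    proof
      show "k ` ?N \<subseteq> M'" using kN by blast
      show "M' \<subseteq> k ` ?N"
      proof
        fix m assume m: "m \<in> M'"
        then have "m \<in> k ` derived K F"
          using M'(3) \<open>derived K P' \<subseteq> k ` derived K F\<close> by blast
        then obtain x where x: "x \<in> derived K F" "m = k x" by (rule imageE)
        have "x \<in> carrier F" using subspaceD(6)[OF F.derived_subspace x(1)] .
        \<comment> \<open>From \<open>m = k x\<close> and \<open>\<rho> m = 0\<close> follows
          \<open>\<pi> x = 0\<close>; thus a preimage of \<open>m\<close> chosen in the derived
          algebra lies in \<open>R\<close> automatically.\<close>
        then have "x \<in> R" using m \<rho>k[of x] by (simp add: M'\<rho> R x(2))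
        then show "m \<in> k ` ?N" using x by blast
      qed
    qed
    have "?D \<subseteq> {x \<in> carrier F. k x \<in> {\<zero>\<^bsub>P'\<^esub>}}"
    proof (rule hopf_denom_least[OF dF RF subspace_preimage[OF klin subspace_zero[OF P'.vectorspace_axioms]]])
      fix x r assume x: "x \<in> carrier F" and r: "r \<in> R"
      \<comment> \<open>As \<open>k r\<close> belongs to the central \<open>M'\<close>, the map
        \<open>k\<close> kills every product having \<open>r\<close> as a factor.\<close>
      have "r \<in> carrier F" "k r \<in> dialg_center P'" using kN[OF r] M'(2) RF r by auto
      then show "x \<stileturn>\<^bsub>F\<^esub> r \<in> {x \<in> carrier F. k x \<in> {\<zero>\<^bsub>P'\<^esub>}} \<and> r \<stileturn>\<^bsub>F\<^esub> x \<in> {x \<in> carrier F. k x \<in> {\<zero>\<^bsub>P'\<^esub>}} \<and>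
          x \<turnstile>\<^bsub>F\<^esub> r \<in> {x \<in> carrier F. k x \<in> {\<zero>\<^bsub>P'\<^esub>}} \<and> r \<turnstile>\<^bsub>F\<^esub> x \<in> {x \<in> carrier F. k x \<in> {\<zero>\<^bsub>P'\<^esub>}}"
        using x by (simp add: dialg_homD(2,3)[OF k] dialg_center_def F.dleft(1) F.dright(1))
    qed
    then have kD: "k x = \<zero>\<^bsub>P'\<^esub>" if "x \<in> ?D" for x using that by blast
    have kres: "linear_map K (F\<lparr>carrier := ?N\<rparr>) (P'\<lparr>carrier := M'\<rparr>) k"
      using kN by (intro linear_map_restrict[OF klin sN M'(1)]) blast
    obtain g where g: "linear_map K ?H (P'\<lparr>carrier := M'\<rparr>) g"
      "\<And>x. x \<in> ?N \<Longrightarrow> g (?D +>\<^bsub>F\<^esub> x) = k x"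
      using hopf_quotient_factor[OF dF idR kres] kD by auto
    \<comment> \<open>A surjection of the Hopf quotient onto \<open>M'\<close> bounds the dimension
      of \<open>M'\<close>. Adding the dimension of \<open>L\<close> on both sides compares
      \<open>P'\<close> with \<open>P\<close>.\<close>
    have "g ` carrier ?H = carrier (P'\<lparr>carrier := M'\<rparr>)"
      using kM by (simp add: image_image g(2))
    then have "vectorspace.dim K (P'\<lparr>carrier := M'\<rparr>) \<le> vectorspace.dim K ?H"
      using linear_map_dim(2)[OF g(1) _ H(1)] by simp
    then show ?thesis using fin_dim_pair[OF pair] finP H(2) by simp
  qed
  then show ?thesis
    unfolding is_multiplier_def using PM finP h fin_dim_pair by blast
qed

section \<open>Tensor products\<close>

lemma free_space_vectorspace:
  assumes "field K" shows "vectorspace K (free_space K S)"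
proof -
  interpret field K by fact
  have add: "finite {s. f s \<oplus>\<^bsub>K\<^esub> g s \<noteq> \<zero>\<^bsub>K\<^esub>}"
    if "finite {s. f s \<noteq> \<zero>\<^bsub>K\<^esub>}" "finite {s. g s \<noteq> \<zero>\<^bsub>K\<^esub>}" for f g :: "'b \<Rightarrow> 'a"
    using finite_subset[OF _ finite_UnI[OF that], of "{s. f s \<oplus>\<^bsub>K\<^esub> g s \<noteq> \<zero>\<^bsub>K\<^esub>}"] by fastforce
  have smult: "finite {s. c \<otimes>\<^bsub>K\<^esub> f s \<noteq> \<zero>\<^bsub>K\<^esub>}"
    if "finite {s. f s \<noteq> \<zero>\<^bsub>K\<^esub>}" "c \<in> carrier K" for c and f :: "'b \<Rightarrow> 'a"
    using that(2) by (intro finite_subset[OF _ that(1)]) auto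
  have neg: "finite {s. \<ominus>\<^bsub>K\<^esub> f s \<noteq> \<zero>\<^bsub>K\<^esub>}"
    if "finite {s. f s \<noteq> \<zero>\<^bsub>K\<^esub>}" "\<forall>s. f s \<in> carrier K" for f :: "'b \<Rightarrow> 'a"
    by (intro finite_subset[OF _ that(1)]) auto
  show ?thesis
  proof (rule vs_criteria[OF field_axioms], goal_cases)
    case 3
    show ?case
    proof
      fix f assume f: "f \<in> carrier (free_space K S)"
      let ?g = "\<lambda>s. \<ominus>\<^bsub>K\<^esub> f s"
      have "?g \<in> carrier (free_space K S)" using f neg by (auto simp: free_space_def)
      moreover have "f \<oplus>\<^bsub>free_space K S\<^esub> ?g = \<zero>\<^bsub>free_space K S\<^esub>"
        using f by (auto simp: free_space_def r_neg)
      ultimately show "\<exists>g\<in>carrier (free_space K S). f \<oplus>\<^bsub>free_space K S\<^esub> g = \<zero>\<^bsub>free_space K S\<^esub>"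
        by blast
    qed
  qed (auto simp: free_space_def add smult a_ac m_assoc l_distr r_distr)
qed

lemma free_gen_mem:
  assumes "field K" "s \<in> S" shows "free_gen K s \<in> carrier (free_space K S)"
proof -
  interpret field K by fact
  show ?thesis using assms(2) by (auto simp: free_space_def free_gen_def)
qed

lemma subspace_finsum:
  assumes "subspace K N W" "g \<in> A \<rightarrow> N" shows "finsum W g A \<in> N"
proof -
  interpret vectorspace K W using subspaceD(1)[OF assms(1)] .
  show ?thesis
    using assms(2)
  proof (induction A rule: infinite_finite_induct)
    case (insert x A)
    then have "g \<in> A \<rightarrow> carrier W" "g x \<in> carrier W" using subspaceD(6)[OF assms(1)] by auto
    then show ?case using insert subspaceD(4)[OF assms(1)] by (simp add: M.finsum_insert)
  qed (simp_all add: M.finsum_infinite subspaceD(3)[OF assms(1)])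
qed

text \<open>The extension is the finite sum of \<open>e s\<close> times \<open>\<phi> s\<close> over
  the support of \<open>e\<close>. The last clause expresses that the generators span, in the form
  in which images of tensor products are bounded later.\<close>

lemma free_space_lift:
  fixes K :: "'k ring" and W :: "('k, 'w, 'z) module_scheme" and S :: "'s set"
  assumes W: "vectorspace K W" and \<phi>: "\<phi> \<in> S \<rightarrow> carrier W"
  obtains f where "linear_map K (free_space K S) W f"
    "\<And>s. s \<in> S \<Longrightarrow> f (free_gen K s) = \<phi> s"
    "\<And>N e. \<lbrakk>subspace K N W; \<phi> \<in> S \<rightarrow> N; e \<in> carrier (free_space K S)\<rbrakk> \<Longrightarrow> f e \<in> N"
proof -
  interpret W: vectorspace K W by fact
  let ?E = "free_space K S"
  have E: "vectorspace K ?E" by (rule free_space_vectorspace) (rule W.field_axioms)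
  let ?supp = "\<lambda>e. {s. e s \<noteq> \<zero>\<^bsub>K\<^esub>}"
  define f where "f e = (\<Oplus>\<^bsub>W\<^esub>s\<in>?supp e. e s \<odot>\<^bsub>W\<^esub> \<phi> s)" for e
  have Ed: "e s \<in> carrier K" "s \<notin> S \<Longrightarrow> e s = \<zero>\<^bsub>K\<^esub>" "finite (?supp e)" "?supp e \<subseteq> S"
    if "e \<in> carrier ?E" for e s
    using that by (auto simp: free_space_def)
  have summand: "(\<lambda>s. e s \<odot>\<^bsub>W\<^esub> \<phi> s) \<in> A \<rightarrow> carrier W" if "e \<in> carrier ?E" "A \<subseteq> S" for e A
    using that \<phi> Ed(1) by blast
  \<comment> \<open>Padding the index set with zero summands makes it possible to write the sums for
    \<open>e\<close>, \<open>e'\<close> and their sum over one common finite set.\<close>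
  have f: "f e = (\<Oplus>\<^bsub>W\<^esub>s\<in>A. e s \<odot>\<^bsub>W\<^esub> \<phi> s)"
    if e: "e \<in> carrier ?E" and A: "finite A" "A \<subseteq> S" "?supp e \<subseteq> A" for e A
    unfolding f_def
  proof (rule W.M.add.finprod_mono_neutral_cong_left[OF A(1,3) _ refl summand[OF e A(2)]])
    fix s assume s: "s \<in> A - ?supp e"
    then have "\<phi> s \<in> carrier W" using A(2) \<phi> by blast
    then show "e s \<odot>\<^bsub>W\<^esub> \<phi> s = \<zero>\<^bsub>W\<^esub>" using s by simp
  qed
  have "linear_map K ?E W f"
  proof (intro linear_mapI E W module_homI)
    fix e assume e: "e \<in> carrier ?E"
    show "f e \<in> carrier W"
      unfolding f_def by (intro W.M.finsum_closed summand[OF e] Ed(4)[OF e])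
  next
    fix e e' assume e: "e \<in> carrier ?E" and e': "e' \<in> carrier ?E"
    let ?A = "?supp e \<union> ?supp e'"
    have A: "finite ?A" "?A \<subseteq> S" using Ed(3,4)[OF e] Ed(3,4)[OF e'] by auto
    interpret E: vectorspace K ?E by (rule E)
    have ee: "e \<oplus>\<^bsub>?E\<^esub> e' \<in> carrier ?E" using e e' by simp
    have ev: "(e \<oplus>\<^bsub>?E\<^esub> e') s = e s \<oplus>\<^bsub>K\<^esub> e' s" for s by (simp add: free_space_def)
    have "?supp (e \<oplus>\<^bsub>?E\<^esub> e') \<subseteq> ?A" by (auto simp: ev)
    then have "f (e \<oplus>\<^bsub>?E\<^esub> e') = (\<Oplus>\<^bsub>W\<^esub>s\<in>?A. (e s \<oplus>\<^bsub>K\<^esub> e' s) \<odot>\<^bsub>W\<^esub> \<phi> s)"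
      using f[OF ee A] by (simp add: ev)
    also have "\<dots> = (\<Oplus>\<^bsub>W\<^esub>s\<in>?A. e s \<odot>\<^bsub>W\<^esub> \<phi> s \<oplus>\<^bsub>W\<^esub> e' s \<odot>\<^bsub>W\<^esub> \<phi> s)"
      using A(2) \<phi> Ed(1)[OF e] Ed(1)[OF e']
      by (intro W.M.finsum_cong') (auto intro!: W.smult_l_distr W.M.a_closed W.smult_closed)
    also have "\<dots> = f e \<oplus>\<^bsub>W\<^esub> f e'"
      using f[OF e A] f[OF e' A] W.M.finsum_addf[OF summand[OF e A(2)] summand[OF e' A(2)]] by simp
    finally show "f (e \<oplus>\<^bsub>?E\<^esub> e') = f e \<oplus>\<^bsub>W\<^esub> f e'" .
  next
    fix c e assume c: "c \<in> carrier K" and e: "e \<in> carrier ?E"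
    interpret E: vectorspace K ?E by (rule E)
    have ce: "c \<odot>\<^bsub>?E\<^esub> e \<in> carrier ?E" using c e by simp
    have ev: "(c \<odot>\<^bsub>?E\<^esub> e) s = c \<otimes>\<^bsub>K\<^esub> e s" for s by (simp add: free_space_def)
    have "?supp (c \<odot>\<^bsub>?E\<^esub> e) \<subseteq> ?supp e" using c by (auto simp: ev)
    then have "f (c \<odot>\<^bsub>?E\<^esub> e) = (\<Oplus>\<^bsub>W\<^esub>s\<in>?supp e. (c \<otimes>\<^bsub>K\<^esub> e s) \<odot>\<^bsub>W\<^esub> \<phi> s)"
      using f[OF ce Ed(3,4)[OF e]] by (simp add: ev)
    also have "\<dots> = (\<Oplus>\<^bsub>W\<^esub>s\<in>?supp e. c \<odot>\<^bsub>W\<^esub> (e s \<odot>\<^bsub>W\<^esub> \<phi> s))"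
      using Ed(4)[OF e] \<phi> Ed(1)[OF e] c
      by (intro W.M.finsum_cong') (auto intro!: W.smult_assoc1 W.smult_closed)
    also have "\<dots> = c \<odot>\<^bsub>W\<^esub> f e"
      unfolding f_def
      by (intro W.finsum_smult_ldistr[symmetric] c Ed(3)[OF e] summand[OF e] Ed(4)[OF e])
    finally show "f (c \<odot>\<^bsub>?E\<^esub> e) = c \<odot>\<^bsub>W\<^esub> f e" .
  qed
  moreover have "f (free_gen K s) = \<phi> s" if s: "s \<in> S" for s
  proof -
    have "f (free_gen K s) = (\<Oplus>\<^bsub>W\<^esub>t\<in>{s}. free_gen K s t \<odot>\<^bsub>W\<^esub> \<phi> t)"
      using s by (intro f free_gen_mem W.field_axioms) (auto simp: free_gen_def)
    also have "\<dots> = \<phi> s"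
    proof -
      have "\<phi> s \<in> carrier W" using s \<phi> by blast
      then show ?thesis by (subst W.M.finsum_insert) (auto simp: free_gen_def)
    qed
    finally show ?thesis .
  qed
  moreover have "f e \<in> N" if "subspace K N W" "\<phi> \<in> S \<rightarrow> N" "e \<in> carrier ?E" for N e
    unfolding f_def using that Ed(1,4)[OF that(3)] subspaceD(5)[OF that(1)]
    by (intro subspace_finsum[OF that(1)]) blast
  ultimately show thesis using that by blast
qed

section \<open>Universal property of the tensor product\<close>

lemma tensor_kernel_subspace:
  assumes U: "vectorspace K U" and V: "vectorspace K V"
  shows "subspace K (tensor_kernel K U V) (free_space K (carrier U \<times> carrier V))"
    and "tensor_relations K U V \<subseteq> carrier (free_space K (carrier U \<times> carrier V))"
proof -
  interpret U: vectorspace K U by fact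
  interpret V: vectorspace K V by fact
  interpret E: vectorspace K "free_space K (carrier U \<times> carrier V)"
    by (rule free_space_vectorspace) (rule U.field_axioms)
  show "tensor_relations K U V \<subseteq> carrier (free_space K (carrier U \<times> carrier V))"
    by (auto simp: tensor_relations_def Let_def intro!: free_gen_mem U.field_axioms E.M.minus_closed)
  then show "subspace K (tensor_kernel K U V) (free_space K (carrier U \<times> carrier V))"
    unfolding tensor_kernel_def by (rule E.span_is_subspace)
qed

lemma tensor_lift:
  assumes U: "vectorspace K U" and V: "vectorspace K V" and W: "vectorspace K W"
    and b: "bilinear_map K U V W b"
  obtains f where "linear_map K (tensor_space K U V) W f"
    "\<And>u v. \<lbrakk>u \<in> carrier U; v \<in> carrier V\<rbrakk> \<Longrightarrow> f (pure_tensor K U V u v) = b u v"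
    "\<And>N. \<lbrakk>subspace K N W; \<forall>u\<in>carrier U. \<forall>v\<in>carrier V. b u v \<in> N\<rbrakk>
      \<Longrightarrow> f ` carrier (tensor_space K U V) \<subseteq> N"
proof -
  interpret U: vectorspace K U by fact
  interpret V: vectorspace K V by fact
  interpret W: vectorspace K W by fact
  let ?S = "carrier U \<times> carrier V"
  let ?E = "free_space K ?S" and ?T = "tensor_kernel K U V"
  have sT: "subspace K ?T ?E" by (rule tensor_kernel_subspace[OF U V])
  obtain e where e: "linear_map K ?E W e"
    and gen: "\<And>s. s \<in> ?S \<Longrightarrow> e (free_gen K s) = (\<lambda>(u, v). b u v) s"
    and im: "\<And>N x. \<lbrakk>subspace K N W; (\<lambda>(u, v). b u v) \<in> ?S \<rightarrow> N; x \<in> carrier ?E\<rbrakk> \<Longrightarrow> e x \<in> N"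
  proof (rule free_space_lift[OF W, of "\<lambda>(u, v). b u v" ?S])
    show "(\<lambda>(u, v). b u v) \<in> ?S \<rightarrow> carrier W" using bilinear_mapD(1)[OF b] by auto
  qed blast
  interpret e: linear_map K ?E W e by (rule e)
  have g: "free_gen K (u, v) \<in> carrier ?E" "e (free_gen K (u, v)) = b u v"
    if "u \<in> carrier U" "v \<in> carrier V" for u v
    using that gen[of "(u, v)"] by (auto intro: free_gen_mem U.field_axioms)
  \<comment> \<open>The four families of relations are the four conditions of bilinearity, so the
    extension \<open>e\<close> of \<open>b\<close> vanishes on them and hence on their span.\<close>
  have "tensor_relations K U V \<subseteq> {x \<in> carrier ?E. e x \<in> {\<zero>\<^bsub>W\<^esub>}}"
  proof
    fix r assume r: "r \<in> tensor_relations K U V"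
    then have "e r = \<zero>\<^bsub>W\<^esub>"
      by (auto simp: tensor_relations_def Let_def g bilinear_mapD[OF b])
    then show "r \<in> {x \<in> carrier ?E. e x \<in> {\<zero>\<^bsub>W\<^esub>}}"
      using r tensor_kernel_subspace(2)[OF U V] by blast
  qed
  then have "?T \<subseteq> {x \<in> carrier ?E. e x \<in> {\<zero>\<^bsub>W\<^esub>}}"
    unfolding tensor_kernel_def
    by (rule span_least[OF subspace_preimage[OF e subspace_zero[OF W]]])
  then have ker: "e x = \<zero>\<^bsub>W\<^esub>" if "x \<in> carrier ?E" "?T +>\<^bsub>?E\<^esub> x = ?T" for x
    using coset_eq_zero_iff[OF sT that(1)] that(2) by blast
  obtain f where f: "linear_map K (tensor_space K U V) W f"
    "\<And>x. x \<in> carrier ?E \<Longrightarrow> f (?T +>\<^bsub>?E\<^esub> x) = e x"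
    unfolding tensor_space_def
    by (rule linear_map_factor[OF coset_linear_map[OF sT] _ e]) (simp_all add: ker)
  show thesis
  proof
    show "linear_map K (tensor_space K U V) W f" by (rule f(1))
    show "f (pure_tensor K U V u v) = b u v" if "u \<in> carrier U" "v \<in> carrier V" for u v
      using that by (simp add: pure_tensor_def f(2) g)
    show "f ` carrier (tensor_space K U V) \<subseteq> N"
      if N: "subspace K N W" "\<forall>u\<in>carrier U. \<forall>v\<in>carrier V. b u v \<in> N" for N
    proof -
      have "(\<lambda>(u, v). b u v) \<in> ?S \<rightarrow> N" using N(2) by auto
      then show ?thesis using im[OF N(1)] by (auto simp: tensor_space_def f(2))
    qed
  qed
qed

lemma pure_tensor_mem:
  assumes "field K" "u \<in> carrier U" "v \<in> carrier V"
  shows "pure_tensor K U V u v \<in> carrier (tensor_space K U V)"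
  using assms by (auto simp: pure_tensor_def tensor_space_def intro: free_gen_mem)

text \<open>The pairings of the Ganea sequence are given on representatives in \<open>F\<close> and
  \<open>T\<close>, whereas the tensor factors are \<open>L/L'\<close> and \<open>Z\<close>. A
  bilinear map vanishing as soon as one argument is in the kernel of \<open>p\<close> or
  \<open>q\<close> descends to \<open>U\<close> and \<open>V\<close>, and from there to their tensor
  product.\<close>

lemma tensor_descend:
  assumes p: "linear_map K A U p" "p ` carrier A = carrier U"
    and q: "linear_map K B V q" "q ` carrier B = carrier V"
    and W: "vectorspace K W" and \<beta>: "bilinear_map K A B W \<beta>"
    and p0: "\<And>a b. \<lbrakk>a \<in> carrier A; b \<in> carrier B; p a = \<zero>\<^bsub>U\<^esub>\<rbrakk> \<Longrightarrow> \<beta> a b = \<zero>\<^bsub>W\<^esub>"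
    and q0: "\<And>a b. \<lbrakk>a \<in> carrier A; b \<in> carrier B; q b = \<zero>\<^bsub>V\<^esub>\<rbrakk> \<Longrightarrow> \<beta> a b = \<zero>\<^bsub>W\<^esub>"
  obtains f where "linear_map K (tensor_space K U V) W f"
    "\<And>a b. \<lbrakk>a \<in> carrier A; b \<in> carrier B\<rbrakk> \<Longrightarrow> f (pure_tensor K U V (p a) (q b)) = \<beta> a b"
    "\<And>N. \<lbrakk>subspace K N W; \<forall>a\<in>carrier A. \<forall>b\<in>carrier B. \<beta> a b \<in> N\<rbrakk>
      \<Longrightarrow> f ` carrier (tensor_space K U V) \<subseteq> N"
proof -
  interpret p: linear_map K A U p by fact
  interpret q: linear_map K B V q by fact
  define b where "b u v = \<beta> (inv_into (carrier A) p u) (inv_into (carrier B) q v)" for u v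
  note \<beta>lin = bilinear_map_linear[OF \<beta> p.V.vectorspace_axioms q.V.vectorspace_axioms W]
  have b: "b (p x) (q y) = \<beta> x y" if x: "x \<in> carrier A" and y: "y \<in> carrier B" for x y
  proof -
    define x' where "x' = inv_into (carrier A) p (p x)"
    define y' where "y' = inv_into (carrier B) q (q y)"
    have x': "x' \<in> carrier A" "p x' = p x" and y': "y' \<in> carrier B" "q y' = q y"
      using x y by (auto simp: x'_def y'_def inv_into_into f_inv_into_f)
    \<comment> \<open>The representatives are exchanged one at a time, so that each step is linear
      in the argument that changes.\<close>
    have "\<beta> x' y' = \<beta> x y'"
      using x x' y' by (intro linear_map_eq_of_diff[OF \<beta>lin(2)] p0 linear_map_eq_diff[OF p(1)]) auto
    also have "\<dots> = \<beta> x y"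
      using x y y' by (intro linear_map_eq_of_diff[OF \<beta>lin(1)] q0 linear_map_eq_diff[OF q(1)]) auto
    finally show ?thesis by (simp add: b_def x'_def y'_def)
  qed
  have exA: "\<exists>x\<in>carrier A. u = p x" if "u \<in> carrier U" for u using that p(2) by blast
  have exB: "\<exists>y\<in>carrier B. v = q y" if "v \<in> carrier V" for v using that q(2) by blast
  have bil: "bilinear_map K U V W b"
    by (rule bilinear_mapI)
      (auto dest!: exA exB simp: b bilinear_mapD[OF \<beta>] p.T_add[symmetric] p.T_smult[symmetric]
        q.T_add[symmetric] q.T_smult[symmetric] simp del: p.T_add p.T_smult q.T_add q.T_smult)
  obtain f where f: "linear_map K (tensor_space K U V) W f"
    "\<And>u v. \<lbrakk>u \<in> carrier U; v \<in> carrier V\<rbrakk> \<Longrightarrow> f (pure_tensor K U V u v) = b u v"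
    "\<And>N. \<lbrakk>subspace K N W; \<forall>u\<in>carrier U. \<forall>v\<in>carrier V. b u v \<in> N\<rbrakk>
      \<Longrightarrow> f ` carrier (tensor_space K U V) \<subseteq> N"
    using tensor_lift[OF p.W.vectorspace_axioms q.W.vectorspace_axioms W bil] by metis
  show thesis
  proof
    show "linear_map K (tensor_space K U V) W f" by (rule f(1))
    show "f (pure_tensor K U V (p x) (q y)) = \<beta> x y" if "x \<in> carrier A" "y \<in> carrier B" for x y
      using that by (simp add: f(2) b)
    show "f ` carrier (tensor_space K U V) \<subseteq> N"
      if N: "subspace K N W" "\<forall>x\<in>carrier A. \<forall>y\<in>carrier B. \<beta> x y \<in> N" for N
      using N(2) by (intro f(3)[OF N(1)]) (auto dest!: exA exB simp: b)
  qed
qed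

lemma linear_map_direct_sum:
  assumes f: "linear_map K U W f" and g: "linear_map K V W g"
  shows "linear_map K (direct_sum U V) W (\<lambda>(x, y). f x \<oplus>\<^bsub>W\<^esub> g y)"
proof -
  interpret f: linear_map K U W f by fact
  interpret g: linear_map K V W g by fact
  show ?thesis
    by (intro linear_mapI direct_sum_is_vs f.V.vectorspace_axioms g.V.vectorspace_axioms
        f.W.vectorspace_axioms module_homI)
      (auto simp: direct_sum_def f.W.module.M.a_ac f.W.module.smult_r_distr)
qed

section \<open>The Ganea sequence\<close>

lemma subspace_of_subspace:
  assumes "subspace K W (V\<lparr>carrier := U\<rparr>)" "subspace K U V"
  shows "subspace K W V"
  using subspaceD[OF assms(1)] subspaceD[OF assms(2)] by (intro subspaceI) auto

text \<open>\<open>R\<close> and \<open>T\<close> are the preimages of zero and of \<open>Z\<close>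
  under \<open>\<pi>\<close>. The spaces T/R, F/(R + F') and (T \<inter> (F' + R))/R are represented
  by their isomorphic images \<open>Z\<close>, \<open>L/L'\<close> and \<open>L' \<inter> Z\<close>.
  In this form the third map of the sequence is \<open>\<pi>\<close> itself on
  representatives.\<close>

locale central_ideal_presentation = L: diassociative_algebra K L + F: diassociative_algebra K F
  for K :: "'k ring" and L :: "('k, 'l) dialgebra" and F :: "('k, 'f) dialgebra" +
  fixes Z :: "'l set" and \<pi> :: "'f \<Rightarrow> 'l"
  assumes Z: "central_ideal K L Z"
    and \<pi>: "\<pi> \<in> dialg_hom K F L" and \<pi>_surj: "\<pi> ` carrier F = carrier L"
begin

definition R where "R = {x \<in> carrier F. \<pi> x = \<zero>\<^bsub>L\<^esub>}"
definition T where "T = {x \<in> carrier F. \<pi> x \<in> Z}"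

abbreviation "ab \<equiv> quot_space L (derived K L)"
abbreviation "Zs \<equiv> L\<lparr>carrier := Z\<rparr>"
abbreviation "mL \<equiv> hopf_quotient K F R"
abbreviation "mLZ \<equiv> hopf_quotient K F T"
abbreviation "LZ \<equiv> L\<lparr>carrier := derived K L \<inter> Z\<rparr>"

lemma dF: "diassociative_algebra K F" and dL: "diassociative_algebra K L"
  by unfold_locales

lemma \<pi>_linear: "linear_map K F L \<pi>"
  by (rule dialg_hom_linear[OF \<pi> dF dL])

lemma \<pi>_mem: "x \<in> carrier F \<Longrightarrow> \<pi> x \<in> carrier L"
  by (rule module_hom_in[OF dialg_homD(1)[OF \<pi>]])

lemma ideal_Z: "dialg_ideal K L Z" and Z_center: "Z \<subseteq> dialg_center L"
  using Z by (simp_all add: central_ideal_def)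

lemma subspace_Z: "subspace K Z L"
  using ideal_Z by (simp add: dialg_ideal_def)

lemma ideal_R: "dialg_ideal K F R" and ideal_T: "dialg_ideal K F T"
  using ideal_preimage[OF dF dL \<pi> ideal_zero[OF dL]] ideal_preimage[OF dF dL \<pi> ideal_Z]
  by (simp_all add: R_def T_def)

lemma subspace_R: "subspace K R F" and subspace_T: "subspace K T F"
  using ideal_R ideal_T by (simp_all add: dialg_ideal_def)

lemma R_subset: "R \<subseteq> T" and T_subset: "T \<subseteq> carrier F" and R_carrier: "R \<subseteq> carrier F"
  using subspaceD(3)[OF subspace_Z] by (auto simp: R_def T_def)

lemma subspace_NR: "subspace K (R \<inter> derived K F) F" and subspace_NT: "subspace K (T \<inter> derived K F) F"
  by (intro subspace_Int subspace_R subspace_T F.derived_subspace)+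

text \<open>Centrality of \<open>Z\<close> enters here: \<open>\<pi> t\<close> is central, so
  \<open>\<pi>\<close> kills each product with \<open>t\<close>, which is why the product lies in
  \<open>R\<close> and not just in \<open>T\<close>.\<close>

lemma prod_T:
  assumes x: "x \<in> carrier F" and t: "t \<in> T"
  shows "x \<stileturn>\<^bsub>F\<^esub> t \<in> R \<inter> derived K F" "t \<stileturn>\<^bsub>F\<^esub> x \<in> R \<inter> derived K F"
    "x \<turnstile>\<^bsub>F\<^esub> t \<in> R \<inter> derived K F" "t \<turnstile>\<^bsub>F\<^esub> x \<in> R \<inter> derived K F"
proof -
  have tF: "t \<in> carrier F" using t T_subset by blast
  have "\<pi> t \<in> dialg_center L" using t Z_center by (auto simp: T_def)
  then have "\<pi> t \<stileturn>\<^bsub>L\<^esub> \<pi> x = \<zero>\<^bsub>L\<^esub> \<and> \<pi> x \<stileturn>\<^bsub>L\<^esub> \<pi> t = \<zero>\<^bsub>L\<^esub> \<and> \<pi> t \<turnstile>\<^bsub>L\<^esub> \<pi> x = \<zero>\<^bsub>L\<^esub> \<and> \<pi> x \<turnstile>\<^bsub>L\<^esub> \<pi> t = \<zero>\<^bsub>L\<^esub>"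
    using \<pi>_mem[OF x] by (simp add: dialg_center_def)
  then show "x \<stileturn>\<^bsub>F\<^esub> t \<in> R \<inter> derived K F" "t \<stileturn>\<^bsub>F\<^esub> x \<in> R \<inter> derived K F"
    "x \<turnstile>\<^bsub>F\<^esub> t \<in> R \<inter> derived K F" "t \<turnstile>\<^bsub>F\<^esub> x \<in> R \<inter> derived K F"
    using x tF F.derived_mem F.dleft(1) F.dright(1) by (simp_all add: R_def dialg_homD(2,3)[OF \<pi>])
qed

lemma denom_T_subset: "hopf_denom K F T \<subseteq> R \<inter> derived K F"
  using prod_T by (intro hopf_denom_least[OF dF T_subset subspace_NR]) blast

lemma coset_zero_R: "x \<in> carrier F \<Longrightarrow> hopf_denom K F R +>\<^bsub>F\<^esub> x = hopf_denom K F R \<longleftrightarrow> x \<in> hopf_denom K F R"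
  by (rule hopf_coset_zero_iff[OF dF R_carrier])

lemma coset_zero_T: "x \<in> carrier F \<Longrightarrow> hopf_denom K F T +>\<^bsub>F\<^esub> x = hopf_denom K F T \<longleftrightarrow> x \<in> hopf_denom K F T"
  by (rule hopf_coset_zero_iff[OF dF T_subset])

lemmas vectorspace_mL = linear_mapD(2)[OF hopf_coset_linear[OF dF ideal_R]]
lemmas vectorspace_mLZ = linear_mapD(2)[OF hopf_coset_linear[OF dF ideal_T]]

section \<open>The pairings of \<open>L/L'\<close> and \<open>Z\<close> with values in the
  multiplier\<close>

lemma ab_linear: "linear_map K F ab (\<lambda>x. derived K L +>\<^bsub>L\<^esub> \<pi> x)"
  and ab_surj: "(\<lambda>x. derived K L +>\<^bsub>L\<^esub> \<pi> x) ` carrier F = carrier ab"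
proof -
  show "linear_map K F ab (\<lambda>x. derived K L +>\<^bsub>L\<^esub> \<pi> x)"
    by (rule linear_map_compose[OF \<pi>_linear coset_linear_map[OF L.derived_subspace]])
  show "(\<lambda>x. derived K L +>\<^bsub>L\<^esub> \<pi> x) ` carrier F = carrier ab"
    by (simp add: \<pi>_surj[symmetric] image_image)
qed

lemma Zs_linear: "linear_map K (F\<lparr>carrier := T\<rparr>) Zs \<pi>"
  and Zs_surj: "\<pi> ` carrier (F\<lparr>carrier := T\<rparr>) = carrier Zs"
proof -
  show "linear_map K (F\<lparr>carrier := T\<rparr>) Zs \<pi>"
    by (rule linear_map_restrict[OF \<pi>_linear subspace_T subspace_Z]) (simp add: T_def)
  have "z \<in> \<pi> ` T" if "z \<in> Z" for z
  proof -
    have "z \<in> \<pi> ` carrier F" using that subspaceD(2)[OF subspace_Z] \<pi>_surj by blast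
    then show ?thesis using that by (auto simp: T_def)
  qed
  then show "\<pi> ` carrier (F\<lparr>carrier := T\<rparr>) = carrier Zs" by (auto simp: T_def)
qed

text \<open>The parameter \<open>op\<close> stands for either product with its arguments in either order.\<close>

lemma pairing:
  assumes op: "bilinear_map K F F F op"
    and T: "\<And>x t. \<lbrakk>x \<in> carrier F; t \<in> T\<rbrakk> \<Longrightarrow> op x t \<in> R \<inter> derived K F"
    and R: "\<And>x r. \<lbrakk>x \<in> carrier F; r \<in> R\<rbrakk> \<Longrightarrow> op x r \<in> hopf_denom K F R \<and> op r x \<in> hopf_denom K F R"
    and F': "\<And>x y t. \<lbrakk>x \<in> carrier F; y \<in> carrier F; t \<in> T\<rbrakk>
      \<Longrightarrow> op (x \<stileturn>\<^bsub>F\<^esub> y) t \<in> hopf_denom K F R \<and> op (x \<turnstile>\<^bsub>F\<^esub> y) t \<in> hopf_denom K F R"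
  shows "bilinear_map K F (F\<lparr>carrier := T\<rparr>) mL (\<lambda>f t. hopf_denom K F R +>\<^bsub>F\<^esub> op f t)" (is ?bilinear)
    and "\<lbrakk>f \<in> carrier F; t \<in> T; derived K L +>\<^bsub>L\<^esub> \<pi> f = derived K L\<rbrakk>
      \<Longrightarrow> hopf_denom K F R +>\<^bsub>F\<^esub> op f t = hopf_denom K F R"
    and "\<lbrakk>f \<in> carrier F; t \<in> T; \<pi> t = \<zero>\<^bsub>L\<^esub>\<rbrakk>
      \<Longrightarrow> hopf_denom K F R +>\<^bsub>F\<^esub> op f t = hopf_denom K F R"
proof -
  let ?D = "hopf_denom K F R"
  interpret c: linear_map K "F\<lparr>carrier := R \<inter> derived K F\<rparr>" mL "\<lambda>x. ?D +>\<^bsub>F\<^esub> x"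
    by (rule hopf_coset_linear[OF dF ideal_R])
  have TF: "t \<in> carrier F" if "t \<in> T" for t using that T_subset by blast
  have sD: "subspace K ?D F" by (rule hopf_denom_subspace[OF dF R_carrier])
  show ?bilinear
    using T TF c.T_add c.T_smult
    by (intro bilinear_mapI) (auto simp: bilinear_mapD[OF op])
  show "?D +>\<^bsub>F\<^esub> op f t = ?D" if f: "f \<in> carrier F" and t: "t \<in> T"
    and zero: "derived K L +>\<^bsub>L\<^esub> \<pi> f = derived K L"
  proof -
    \<comment> \<open>Vanishing in \<open>L/L'\<close> means \<open>f = f' + r\<close> with
      \<open>f'\<close> in \<open>F'\<close> and \<open>r\<close> in \<open>R\<close>, because
      \<open>\<pi>\<close> maps \<open>F'\<close> onto \<open>L'\<close>. The two parts are treated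
      separately.\<close>
    have "\<pi> f \<in> \<pi> ` derived K F"
      using zero coset_eq_zero_iff[OF L.derived_subspace \<pi>_mem[OF f]] image_derived[OF dF dL \<pi> \<pi>_surj]
      by simp
    then obtain f' where f': "f' \<in> derived K F" "\<pi> f = \<pi> f'" by blast
    have f'F: "f' \<in> carrier F" using f'(1) subspaceD(6)[OF F.derived_subspace] by blast
    have "\<pi> (f \<ominus>\<^bsub>F\<^esub> f') = \<zero>\<^bsub>L\<^esub>" by (rule linear_map_eq_diff[OF \<pi>_linear f f'F f'(2)])
    then have r: "f \<ominus>\<^bsub>F\<^esub> f' \<in> R" using f f'F by (simp add: R_def)
    \<comment> \<open>For fixed \<open>t\<close> the elements whose product with \<open>t\<close>
      lies in \<open>?D\<close> form a subspace, so it is enough to look at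
      \<open>x \<stileturn> y\<close> and \<open>x \<turnstile> y\<close>.\<close>
    have "derived K F \<subseteq> {x \<in> carrier F. op x t \<in> ?D}"
      using F' t TF[OF t] F.dleft(1) F.dright(1)
      by (intro F.derived_least subspace_preimage[OF bilinear_map_linear(2)[OF op] sD]
          F.vectorspace_axioms) auto
    then have "op f' t \<in> ?D" using f'(1) by blast
    moreover have "op (f \<ominus>\<^bsub>F\<^esub> f') t \<in> ?D" using R r TF[OF t] by blast
    moreover have "op f t = op f' t \<oplus>\<^bsub>F\<^esub> op (f \<ominus>\<^bsub>F\<^esub> f') t"
      using bilinear_mapD(2)[OF op f'F TF[OF t], of "f \<ominus>\<^bsub>F\<^esub> f'"] f f'F
      by (simp add: F.M.add_minus_cancel)
    ultimately have "op f t \<in> ?D" using subspaceD(4)[OF sD] by simp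
    then show ?thesis using coset_zero_R bilinear_mapD(1)[OF op f TF[OF t]] by blast
  qed
  show "?D +>\<^bsub>F\<^esub> op f t = ?D" if f: "f \<in> carrier F" and t: "t \<in> T" and zero: "\<pi> t = \<zero>\<^bsub>L\<^esub>"
  proof -
    have "op f t \<in> ?D" using R[OF f] zero TF[OF t] by (simp add: R_def)
    then show ?thesis using coset_zero_R bilinear_mapD(1)[OF op f TF[OF t]] by blast
  qed
qed

lemma ganea_left:
  assumes "bilinear_map K F F F op"
    "\<And>x t. \<lbrakk>x \<in> carrier F; t \<in> T\<rbrakk> \<Longrightarrow> op x t \<in> R \<inter> derived K F"
    "\<And>x r. \<lbrakk>x \<in> carrier F; r \<in> R\<rbrakk> \<Longrightarrow> op x r \<in> hopf_denom K F R \<and> op r x \<in> hopf_denom K F R"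
    "\<And>x y t. \<lbrakk>x \<in> carrier F; y \<in> carrier F; t \<in> T\<rbrakk>
      \<Longrightarrow> op (x \<stileturn>\<^bsub>F\<^esub> y) t \<in> hopf_denom K F R \<and> op (x \<turnstile>\<^bsub>F\<^esub> y) t \<in> hopf_denom K F R"
  shows "\<exists>\<alpha>. linear_map K (tensor_space K ab Zs) mL \<alpha> \<and>
    (\<forall>f\<in>carrier F. \<forall>t\<in>T. \<alpha> (pure_tensor K ab Zs (derived K L +>\<^bsub>L\<^esub> \<pi> f) (\<pi> t)) = hopf_denom K F R +>\<^bsub>F\<^esub> op f t) \<and>
    (\<forall>N. subspace K N mL \<longrightarrow> (\<forall>f\<in>carrier F. \<forall>t\<in>T. hopf_denom K F R +>\<^bsub>F\<^esub> op f t \<in> N)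
      \<longrightarrow> \<alpha> ` carrier (tensor_space K ab Zs) \<subseteq> N)"
proof (rule tensor_descend[OF ab_linear ab_surj Zs_linear Zs_surj vectorspace_mL pairing(1)[OF assms]])
  fix \<alpha>
  assume "linear_map K (tensor_space K ab Zs) mL \<alpha>"
    and "\<And>a b. \<lbrakk>a \<in> carrier F; b \<in> carrier (F\<lparr>carrier := T\<rparr>)\<rbrakk> \<Longrightarrow>
      \<alpha> (pure_tensor K ab Zs (derived K L +>\<^bsub>L\<^esub> \<pi> a) (\<pi> b)) = hopf_denom K F R +>\<^bsub>F\<^esub> op a b"
    and "\<And>N. \<lbrakk>subspace K N mL; \<forall>a\<in>carrier F. \<forall>b\<in>carrier (F\<lparr>carrier := T\<rparr>). hopf_denom K F R +>\<^bsub>F\<^esub> op a b \<in> N\<rbrakk>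
      \<Longrightarrow> \<alpha> ` carrier (tensor_space K ab Zs) \<subseteq> N"
  then show ?thesis by (intro exI[of _ \<alpha>] conjI ballI allI impI) simp_all
next
  fix a b assume "a \<in> carrier F" "b \<in> carrier (F\<lparr>carrier := T\<rparr>)" "derived K L +>\<^bsub>L\<^esub> \<pi> a = \<zero>\<^bsub>ab\<^esub>"
  then show "hopf_denom K F R +>\<^bsub>F\<^esub> op a b = \<zero>\<^bsub>mL\<^esub>" using pairing(2)[OF assms, of a b] by simp
next
  fix a b assume "a \<in> carrier F" "b \<in> carrier (F\<lparr>carrier := T\<rparr>)" "\<pi> b = \<zero>\<^bsub>Zs\<^esub>"
  then show "hopf_denom K F R +>\<^bsub>F\<^esub> op a b = \<zero>\<^bsub>mL\<^esub>" using pairing(3)[OF assms, of a b] by simp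
qed

text \<open>The first argument of \<open>op\<close> is still the element of \<open>F\<close>: for a
  product with \<open>t\<close> on the left, \<open>op\<close> is the product with its arguments
  exchanged. Only the tensor factors change their order, so \<open>pairing\<close> serves all four
  maps.\<close>

lemma ganea_right:
  assumes "bilinear_map K F F F op"
    "\<And>x t. \<lbrakk>x \<in> carrier F; t \<in> T\<rbrakk> \<Longrightarrow> op x t \<in> R \<inter> derived K F"
    "\<And>x r. \<lbrakk>x \<in> carrier F; r \<in> R\<rbrakk> \<Longrightarrow> op x r \<in> hopf_denom K F R \<and> op r x \<in> hopf_denom K F R"
    "\<And>x y t. \<lbrakk>x \<in> carrier F; y \<in> carrier F; t \<in> T\<rbrakk>
      \<Longrightarrow> op (x \<stileturn>\<^bsub>F\<^esub> y) t \<in> hopf_denom K F R \<and> op (x \<turnstile>\<^bsub>F\<^esub> y) t \<in> hopf_denom K F R"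
  shows "\<exists>\<theta>. linear_map K (tensor_space K Zs ab) mL \<theta> \<and>
    (\<forall>f\<in>carrier F. \<forall>t\<in>T. \<theta> (pure_tensor K Zs ab (\<pi> t) (derived K L +>\<^bsub>L\<^esub> \<pi> f)) = hopf_denom K F R +>\<^bsub>F\<^esub> op f t) \<and>
    (\<forall>N. subspace K N mL \<longrightarrow> (\<forall>f\<in>carrier F. \<forall>t\<in>T. hopf_denom K F R +>\<^bsub>F\<^esub> op f t \<in> N)
      \<longrightarrow> \<theta> ` carrier (tensor_space K Zs ab) \<subseteq> N)"
proof (rule tensor_descend[OF Zs_linear Zs_surj ab_linear ab_surj vectorspace_mL
      bilinear_map_flip[OF pairing(1)[OF assms]]])
  fix \<theta>
  assume "linear_map K (tensor_space K Zs ab) mL \<theta>"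
    and "\<And>b a. \<lbrakk>b \<in> carrier (F\<lparr>carrier := T\<rparr>); a \<in> carrier F\<rbrakk> \<Longrightarrow>
      \<theta> (pure_tensor K Zs ab (\<pi> b) (derived K L +>\<^bsub>L\<^esub> \<pi> a)) = hopf_denom K F R +>\<^bsub>F\<^esub> op a b"
    and "\<And>N. \<lbrakk>subspace K N mL; \<forall>b\<in>carrier (F\<lparr>carrier := T\<rparr>). \<forall>a\<in>carrier F. hopf_denom K F R +>\<^bsub>F\<^esub> op a b \<in> N\<rbrakk>
      \<Longrightarrow> \<theta> ` carrier (tensor_space K Zs ab) \<subseteq> N"
  then show ?thesis by (intro exI[of _ \<theta>] conjI ballI allI impI) simp_all
next
  fix b a assume "b \<in> carrier (F\<lparr>carrier := T\<rparr>)" "a \<in> carrier F" "\<pi> b = \<zero>\<^bsub>Zs\<^esub>"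
  then show "hopf_denom K F R +>\<^bsub>F\<^esub> op a b = \<zero>\<^bsub>mL\<^esub>" using pairing(3)[OF assms, of a b] by simp
next
  fix b a assume "b \<in> carrier (F\<lparr>carrier := T\<rparr>)" "a \<in> carrier F" "derived K L +>\<^bsub>L\<^esub> \<pi> a = \<zero>\<^bsub>ab\<^esub>"
  then show "hopf_denom K F R +>\<^bsub>F\<^esub> op a b = \<zero>\<^bsub>mL\<^esub>" using pairing(2)[OF assms, of a b] by simp
qed


text \<open>Both maps are induced by inclusions of numerators. The first is well defined since
  \<open>D\<^sub>R \<subseteq> D\<^sub>T\<close>, the second since \<open>D\<^sub>T\<close> lies in
  \<open>R\<close>, the kernel of \<open>\<pi>\<close>.\<close>

lemma hopf_maps:
  obtains \<sigma> \<tau> where "linear_map K mL mLZ \<sigma>" "linear_map K mLZ LZ \<tau>"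
    "\<And>x. x \<in> R \<inter> derived K F \<Longrightarrow> \<sigma> (hopf_denom K F R +>\<^bsub>F\<^esub> x) = hopf_denom K F T +>\<^bsub>F\<^esub> x"
    "\<And>x. x \<in> T \<inter> derived K F \<Longrightarrow> \<tau> (hopf_denom K F T +>\<^bsub>F\<^esub> x) = \<pi> x"
proof -
  have NR_NT: "subspace K (R \<inter> derived K F) (F\<lparr>carrier := T \<inter> derived K F\<rparr>)"
    using R_subset by (intro subspace_in_subspace subspace_NR subspace_NT) blast
  have s: "linear_map K (F\<lparr>carrier := R \<inter> derived K F\<rparr>) mLZ (\<lambda>x. hopf_denom K F T +>\<^bsub>F\<^esub> x)"
    using linear_map_restrict_domain[OF hopf_coset_linear[OF dF ideal_T] NR_NT] by simp
  have s0: "hopf_denom K F T +>\<^bsub>F\<^esub> x = \<zero>\<^bsub>mLZ\<^esub>" if "x \<in> hopf_denom K F R" for x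
  proof -
    have "hopf_denom K F R \<subseteq> hopf_denom K F T"
      using R_subset hopf_denom_mem[OF dF T_subset]
      by (intro hopf_denom_least[OF dF R_carrier] hopf_denom_subspace[OF dF T_subset]) blast
    then have xT: "x \<in> hopf_denom K F T" using that by blast
    then have "x \<in> carrier F" using subspaceD(6)[OF hopf_denom_subspace[OF dF T_subset]] by blast
    then show ?thesis using coset_zero_T xT by simp
  qed
  obtain \<sigma> where \<sigma>: "linear_map K mL mLZ \<sigma>"
    "\<And>x. x \<in> R \<inter> derived K F \<Longrightarrow> \<sigma> (hopf_denom K F R +>\<^bsub>F\<^esub> x) = hopf_denom K F T +>\<^bsub>F\<^esub> x"
    using hopf_quotient_factor[OF dF ideal_R s s0] by blast
  have "\<pi> x \<in> derived K L \<inter> Z" if "x \<in> T \<inter> derived K F" for x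
    using that image_derived[OF dF dL \<pi> \<pi>_surj] by (auto simp: T_def)
  then have t: "linear_map K (F\<lparr>carrier := T \<inter> derived K F\<rparr>) LZ \<pi>"
    by (intro linear_map_restrict[OF \<pi>_linear subspace_NT] subspace_Int L.derived_subspace subspace_Z)
  have t0: "\<pi> x = \<zero>\<^bsub>LZ\<^esub>" if "x \<in> hopf_denom K F T" for x
    using that denom_T_subset by (auto simp: R_def)
  obtain \<tau> where \<tau>: "linear_map K mLZ LZ \<tau>"
    "\<And>x. x \<in> T \<inter> derived K F \<Longrightarrow> \<tau> (hopf_denom K F T +>\<^bsub>F\<^esub> x) = \<pi> x"
    using hopf_quotient_factor[OF dF ideal_T t t0] by blast
  show thesis using that \<sigma> \<tau> by blast
qed

text \<open>The space \<open>D\<^sub>T/D\<^sub>R\<close> is spanned by the cosets of products of an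
  element of \<open>F\<close> with one of \<open>T\<close>: the preimage of \<open>N\<close> is a
  subspace of \<open>F\<close> containing the generators of \<open>D\<^sub>T\<close>.\<close>

lemma denom_T_coset_mem:
  assumes N: "subspace K N mL"
    and prod: "\<And>f t. \<lbrakk>f \<in> carrier F; t \<in> T\<rbrakk> \<Longrightarrow>
      hopf_denom K F R +>\<^bsub>F\<^esub> (f \<stileturn>\<^bsub>F\<^esub> t) \<in> N \<and> hopf_denom K F R +>\<^bsub>F\<^esub> (t \<stileturn>\<^bsub>F\<^esub> f) \<in> N \<and>
      hopf_denom K F R +>\<^bsub>F\<^esub> (f \<turnstile>\<^bsub>F\<^esub> t) \<in> N \<and> hopf_denom K F R +>\<^bsub>F\<^esub> (t \<turnstile>\<^bsub>F\<^esub> f) \<in> N"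
    and x: "x \<in> hopf_denom K F T"
  shows "hopf_denom K F R +>\<^bsub>F\<^esub> x \<in> N"
proof -
  let ?N = "{x \<in> carrier (F\<lparr>carrier := R \<inter> derived K F\<rparr>). hopf_denom K F R +>\<^bsub>F\<^esub> x \<in> N}"
  have "subspace K ?N F"
    by (rule subspace_of_subspace[OF subspace_preimage[OF hopf_coset_linear[OF dF ideal_R] N]
          subspace_NR])
  then have "hopf_denom K F T \<subseteq> ?N"
    by (rule hopf_denom_least[OF dF T_subset]) (use prod_T prod in simp)
  then show ?thesis using x by blast
qed

lemma ganea_exact:
  defines "abZ \<equiv> tensor_space K ab Zs" and "Zab \<equiv> tensor_space K Zs ab"
  shows "\<exists>\<alpha>l \<theta>l \<alpha>r \<theta>r \<sigma> \<tau>.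
         linear_map K abZ mL \<alpha>l \<and> linear_map K Zab mL \<theta>l \<and>
         linear_map K abZ mL \<alpha>r \<and> linear_map K Zab mL \<theta>r \<and>
         (\<forall>f\<in>carrier F. \<forall>t\<in>T.
            \<alpha>l (pure_tensor K ab Zs (derived K L +>\<^bsub>L\<^esub> \<pi> f) (\<pi> t)) = hopf_denom K F R +>\<^bsub>F\<^esub> (f \<stileturn>\<^bsub>F\<^esub> t) \<and>
            \<theta>l (pure_tensor K Zs ab (\<pi> t) (derived K L +>\<^bsub>L\<^esub> \<pi> f)) = hopf_denom K F R +>\<^bsub>F\<^esub> (t \<stileturn>\<^bsub>F\<^esub> f) \<and>
            \<alpha>r (pure_tensor K ab Zs (derived K L +>\<^bsub>L\<^esub> \<pi> f) (\<pi> t)) = hopf_denom K F R +>\<^bsub>F\<^esub> (f \<turnstile>\<^bsub>F\<^esub> t) \<and>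
            \<theta>r (pure_tensor K Zs ab (\<pi> t) (derived K L +>\<^bsub>L\<^esub> \<pi> f)) = hopf_denom K F R +>\<^bsub>F\<^esub> (t \<turnstile>\<^bsub>F\<^esub> f)) \<and>
         (\<forall>x\<in>R \<inter> derived K F. \<sigma> (hopf_denom K F R +>\<^bsub>F\<^esub> x) = hopf_denom K F T +>\<^bsub>F\<^esub> x) \<and>
         (\<forall>x\<in>T \<inter> derived K F. \<tau> (hopf_denom K F T +>\<^bsub>F\<^esub> x) = \<pi> x) \<and>
         exact_at K (direct_sum (direct_sum abZ Zab) (direct_sum abZ Zab))
           (\<lambda>((a, b), (c, d)). \<alpha>l a \<oplus>\<^bsub>mL\<^esub> \<theta>l b \<oplus>\<^bsub>mL\<^esub> \<alpha>r c \<oplus>\<^bsub>mL\<^esub> \<theta>r d) mL \<sigma> mLZ \<and>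
         exact_at K mL \<sigma> mLZ \<tau> LZ \<and>
         \<tau> ` carrier mLZ = carrier LZ"
proof -
  let ?c = "\<lambda>x. hopf_denom K F R +>\<^bsub>F\<^esub> x"
  interpret mL: vectorspace K mL by (rule vectorspace_mL)
  have TF: "t \<in> carrier F" if "t \<in> T" for t using that T_subset by blast
  have T\<pi>: "y \<stileturn>\<^bsub>F\<^esub> t \<in> R" "t \<stileturn>\<^bsub>F\<^esub> y \<in> R" "y \<turnstile>\<^bsub>F\<^esub> t \<in> R" "t \<turnstile>\<^bsub>F\<^esub> y \<in> R"
    if "y \<in> carrier F" "t \<in> T" for y t using prod_T[OF that] by auto
  note D = hopf_denom_mem[OF dF R_carrier]
  \<comment> \<open>Products of \<open>F'\<close> with \<open>t\<close> fall into
    \<open>D\<^sub>R\<close> because \<open>(x \<stileturn> y) \<stileturn> t = x \<stileturn> (y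
    \<stileturn> t)\<close> and \<open>(x \<turnstile> y) \<stileturn> t = x \<turnstile> (y
    \<stileturn> t)\<close>, where the inner product is in \<open>R\<close>.\<close>
  obtain \<alpha>l where \<alpha>l: "linear_map K abZ mL \<alpha>l"
    "\<forall>f\<in>carrier F. \<forall>t\<in>T. \<alpha>l (pure_tensor K ab Zs (derived K L +>\<^bsub>L\<^esub> \<pi> f) (\<pi> t)) = ?c (f \<stileturn>\<^bsub>F\<^esub> t)"
    "\<forall>N. subspace K N mL \<longrightarrow> (\<forall>f\<in>carrier F. \<forall>t\<in>T. ?c (f \<stileturn>\<^bsub>F\<^esub> t) \<in> N) \<longrightarrow> \<alpha>l ` carrier abZ \<subseteq> N"
    using ganea_left[OF F.dleft_bilinear prod_T(1)] D T\<pi> TF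
    by (auto simp: abZ_def F.dleft_assoc F.dright_dleft_assoc)
  \<comment> \<open>Here the identities are \<open>(x \<stileturn> y) \<turnstile> t = (x
    \<turnstile> y) \<turnstile> t = x \<turnstile> (y \<turnstile> t)\<close>.\<close>
  obtain \<alpha>r where \<alpha>r: "linear_map K abZ mL \<alpha>r"
    "\<forall>f\<in>carrier F. \<forall>t\<in>T. \<alpha>r (pure_tensor K ab Zs (derived K L +>\<^bsub>L\<^esub> \<pi> f) (\<pi> t)) = ?c (f \<turnstile>\<^bsub>F\<^esub> t)"
    "\<forall>N. subspace K N mL \<longrightarrow> (\<forall>f\<in>carrier F. \<forall>t\<in>T. ?c (f \<turnstile>\<^bsub>F\<^esub> t) \<in> N) \<longrightarrow> \<alpha>r ` carrier abZ \<subseteq> N"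
    using ganea_left[OF F.dright_bilinear prod_T(3)] D T\<pi> TF
    by (auto simp: abZ_def F.dleft_dright' F.dright_assoc)
  \<comment> \<open>With \<open>t\<close> on the left: \<open>t \<stileturn> (x \<turnstile> y) = t
    \<stileturn> (x \<stileturn> y) = (t \<stileturn> x) \<stileturn> y\<close>, and
    \<open>t \<stileturn> x\<close> is in \<open>R\<close>.\<close>
  obtain \<theta>l where \<theta>l: "linear_map K Zab mL \<theta>l"
    "\<forall>f\<in>carrier F. \<forall>t\<in>T. \<theta>l (pure_tensor K Zs ab (\<pi> t) (derived K L +>\<^bsub>L\<^esub> \<pi> f)) = ?c (t \<stileturn>\<^bsub>F\<^esub> f)"
    "\<forall>N. subspace K N mL \<longrightarrow> (\<forall>f\<in>carrier F. \<forall>t\<in>T. ?c (t \<stileturn>\<^bsub>F\<^esub> f) \<in> N) \<longrightarrow> \<theta>l ` carrier Zab \<subseteq> N"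
    using ganea_right[OF bilinear_map_flip[OF F.dleft_bilinear] prod_T(2)] D T\<pi> TF
    by (auto simp: Zab_def F.dleft_dright[symmetric] F.dleft_assoc[symmetric])
  \<comment> \<open>The remaining identities are \<open>t \<turnstile> (x \<stileturn> y) = (t
    \<turnstile> x) \<stileturn> y\<close> and \<open>t \<turnstile> (x \<turnstile> y) = (t
    \<turnstile> x) \<turnstile> y\<close>.\<close>
  obtain \<theta>r where \<theta>r: "linear_map K Zab mL \<theta>r"
    "\<forall>f\<in>carrier F. \<forall>t\<in>T. \<theta>r (pure_tensor K Zs ab (\<pi> t) (derived K L +>\<^bsub>L\<^esub> \<pi> f)) = ?c (t \<turnstile>\<^bsub>F\<^esub> f)"
    "\<forall>N. subspace K N mL \<longrightarrow> (\<forall>f\<in>carrier F. \<forall>t\<in>T. ?c (t \<turnstile>\<^bsub>F\<^esub> f) \<in> N) \<longrightarrow> \<theta>r ` carrier Zab \<subseteq> N"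
    using ganea_right[OF bilinear_map_flip[OF F.dright_bilinear] prod_T(4)] D T\<pi> TF
    by (auto simp: Zab_def F.dright_dleft_assoc[symmetric] F.dright_assoc[symmetric])
  obtain \<sigma> \<tau> where \<sigma>\<tau>: "linear_map K mL mLZ \<sigma>" "linear_map K mLZ LZ \<tau>"
    and \<sigma>: "\<And>x. x \<in> R \<inter> derived K F \<Longrightarrow> \<sigma> (?c x) = hopf_denom K F T +>\<^bsub>F\<^esub> x"
    and \<tau>: "\<And>x. x \<in> T \<inter> derived K F \<Longrightarrow> \<tau> (hopf_denom K F T +>\<^bsub>F\<^esub> x) = \<pi> x"
    using hopf_maps by blast
  interpret al: linear_map K abZ mL \<alpha>l by (rule \<alpha>l(1))
  interpret ar: linear_map K abZ mL \<alpha>r by (rule \<alpha>r(1))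
  interpret tl: linear_map K Zab mL \<theta>l by (rule \<theta>l(1))
  interpret tr: linear_map K Zab mL \<theta>r by (rule \<theta>r(1))
  let ?D = "direct_sum (direct_sum abZ Zab) (direct_sum abZ Zab)"
  let ?\<phi> = "\<lambda>((a, b), (c, d)). \<alpha>l a \<oplus>\<^bsub>mL\<^esub> \<theta>l b \<oplus>\<^bsub>mL\<^esub> \<alpha>r c \<oplus>\<^bsub>mL\<^esub> \<theta>r d"
  have carrier_D: "carrier ?D = (carrier abZ \<times> carrier Zab) \<times> (carrier abZ \<times> carrier Zab)"
    by (simp add: direct_sum_def)
  have \<phi>: "linear_map K ?D mL ?\<phi>"
    by (rule linear_map_cong[OF linear_map_direct_sum[OF
            linear_map_direct_sum[OF \<alpha>l(1) \<theta>l(1)] linear_map_direct_sum[OF \<alpha>r(1) \<theta>r(1)]]])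
      (auto simp: carrier_D mL.M.a_assoc simp del: hopf_quotient_sel)
  define Ker where "Ker = {v \<in> carrier mL. \<sigma> v = \<zero>\<^bsub>mLZ\<^esub>}"
  have sker: "subspace K Ker mL"
    using subspace_preimage[OF \<sigma>\<tau>(1) subspace_zero[OF vectorspace_mLZ]] by (simp add: Ker_def)
  have sim: "subspace K (?\<phi> ` carrier ?D) mL"
    by (rule subspace_image[OF \<phi> subspace_carrier[OF linear_mapD(1)[OF \<phi>]]])
  have "exact_at K ?D ?\<phi> mL \<sigma> mLZ"
    unfolding exact_at_def Ker_def[symmetric]
  proof (intro conjI \<phi> \<sigma>\<tau>(1) subset_antisym)
    \<comment> \<open>The values of the four maps on pure tensors are cosets of generators of
      \<open>D\<^sub>T\<close>. Placing these in \<open>Ker\<close> bounds each of the four images,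
      by the clause on subspaces.\<close>
    have ker: "?c x \<in> Ker" if "x \<in> hopf_denom K F T" for x
      using that denom_T_subset coset_zero_T[of x] \<sigma>[of x]
        subspaceD(6)[OF hopf_denom_subspace[OF dF T_subset] that] by (auto simp: Ker_def)
    note DT = hopf_denom_mem[OF dF T_subset]
    have "\<alpha>l ` carrier abZ \<subseteq> Ker"
      "\<alpha>r ` carrier abZ \<subseteq> Ker"
      "\<theta>l ` carrier Zab \<subseteq> Ker"
      "\<theta>r ` carrier Zab \<subseteq> Ker"
      by (rule \<alpha>l(3)[rule_format, OF sker] \<alpha>r(3)[rule_format, OF sker]
          \<theta>l(3)[rule_format, OF sker] \<theta>r(3)[rule_format, OF sker]; rule ker; rule DT; assumption)+
    then show "?\<phi> ` carrier ?D \<subseteq> Ker"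
      unfolding carrier_D by (auto intro!: subspaceD(4)[OF sker] simp del: hopf_quotient_sel)
  next
    \<comment> \<open>Putting zero in the other three components shows that the image of the sum
      contains the image of each summand.\<close>
    have im_\<alpha>: "\<alpha>l a \<in> ?\<phi> ` carrier ?D" "\<alpha>r a \<in> ?\<phi> ` carrier ?D" if "a \<in> carrier abZ" for a
    proof -
      have "\<alpha>l a = ?\<phi> ((a, \<zero>\<^bsub>Zab\<^esub>), (\<zero>\<^bsub>abZ\<^esub>, \<zero>\<^bsub>Zab\<^esub>))" "\<alpha>r a = ?\<phi> ((\<zero>\<^bsub>abZ\<^esub>, \<zero>\<^bsub>Zab\<^esub>), (a, \<zero>\<^bsub>Zab\<^esub>))"
        using that by (simp_all del: hopf_quotient_sel)
      then show "\<alpha>l a \<in> ?\<phi> ` carrier ?D" "\<alpha>r a \<in> ?\<phi> ` carrier ?D"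
        unfolding carrier_D using that by (blast intro: image_eqI al.V.module.M.zero_closed tl.V.module.M.zero_closed)+
    qed
    have im_\<theta>: "\<theta>l a \<in> ?\<phi> ` carrier ?D" "\<theta>r a \<in> ?\<phi> ` carrier ?D" if "a \<in> carrier Zab" for a
    proof -
      have "\<theta>l a = ?\<phi> ((\<zero>\<^bsub>abZ\<^esub>, a), (\<zero>\<^bsub>abZ\<^esub>, \<zero>\<^bsub>Zab\<^esub>))" "\<theta>r a = ?\<phi> ((\<zero>\<^bsub>abZ\<^esub>, \<zero>\<^bsub>Zab\<^esub>), (\<zero>\<^bsub>abZ\<^esub>, a))"
        using that by (simp_all del: hopf_quotient_sel)
      then show "\<theta>l a \<in> ?\<phi> ` carrier ?D" "\<theta>r a \<in> ?\<phi> ` carrier ?D"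
        unfolding carrier_D using that by (blast intro: image_eqI al.V.module.M.zero_closed tl.V.module.M.zero_closed)+
    qed
    have pure: "pure_tensor K ab Zs (derived K L +>\<^bsub>L\<^esub> \<pi> f) (\<pi> t) \<in> carrier abZ"
      "pure_tensor K Zs ab (\<pi> t) (derived K L +>\<^bsub>L\<^esub> \<pi> f) \<in> carrier Zab"
      if "f \<in> carrier F" "t \<in> T" for f t
      unfolding abZ_def Zab_def using that \<pi>_mem
      by (auto intro!: pure_tensor_mem L.field_axioms simp: T_def simp del: hopf_quotient_sel)
    \<comment> \<open>The converse inclusion: each generator of \<open>D\<^sub>T\<close> has a coset
      that is a value on a pure tensor, so the image of \<open>?\<phi>\<close>, being a subspace,
      contains \<open>D\<^sub>T/D\<^sub>R\<close>.\<close>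
    have im: "?c x \<in> ?\<phi> ` carrier ?D" if "x \<in> hopf_denom K F T" for x
    proof (rule denom_T_coset_mem[OF sim _ that])
      fix f t assume ft: "f \<in> carrier F" "t \<in> T"
      show "?c (f \<stileturn>\<^bsub>F\<^esub> t) \<in> ?\<phi> ` carrier ?D \<and> ?c (t \<stileturn>\<^bsub>F\<^esub> f) \<in> ?\<phi> ` carrier ?D \<and>
          ?c (f \<turnstile>\<^bsub>F\<^esub> t) \<in> ?\<phi> ` carrier ?D \<and> ?c (t \<turnstile>\<^bsub>F\<^esub> f) \<in> ?\<phi> ` carrier ?D"
        using im_\<alpha>[OF pure(1)[OF ft]] im_\<theta>[OF pure(2)[OF ft]]
        unfolding \<alpha>l(2)[rule_format, OF ft] \<alpha>r(2)[rule_format, OF ft]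
          \<theta>l(2)[rule_format, OF ft] \<theta>r(2)[rule_format, OF ft]
        by (intro conjI)
    qed
    show "Ker \<subseteq> ?\<phi> ` carrier ?D"
    proof
      fix v assume "v \<in> Ker"
      then obtain x where x: "x \<in> R \<inter> derived K F" "v = ?c x" "\<sigma> v = hopf_denom K F T" by (auto simp: Ker_def)
      then have "x \<in> hopf_denom K F T" using \<sigma>[OF x(1)] coset_zero_T R_carrier by auto
      then show "v \<in> ?\<phi> ` carrier ?D" unfolding x(2) by (rule im)
    qed
  qed
  moreover have "exact_at K mL \<sigma> mLZ \<tau> LZ"
    unfolding exact_at_def
  proof (intro conjI \<sigma>\<tau> subset_antisym)
    show "\<sigma> ` carrier mL \<subseteq> {v \<in> carrier mLZ. \<tau> v = \<zero>\<^bsub>LZ\<^esub>}"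
    proof
      fix v assume "v \<in> \<sigma> ` carrier mL"
      then obtain x where x: "x \<in> R \<inter> derived K F" "v = hopf_denom K F T +>\<^bsub>F\<^esub> x" using \<sigma> by auto
      then show "v \<in> {v \<in> carrier mLZ. \<tau> v = \<zero>\<^bsub>LZ\<^esub>}"
        using R_subset \<tau>[of x] by (auto simp: R_def)
    qed
    show "{v \<in> carrier mLZ. \<tau> v = \<zero>\<^bsub>LZ\<^esub>} \<subseteq> \<sigma> ` carrier mL"
    proof
      fix v assume "v \<in> {v \<in> carrier mLZ. \<tau> v = \<zero>\<^bsub>LZ\<^esub>}"
      then obtain x where x: "x \<in> T \<inter> derived K F" "v = hopf_denom K F T +>\<^bsub>F\<^esub> x" "\<tau> v = \<zero>\<^bsub>L\<^esub>" by auto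
      \<comment> \<open>On representatives \<open>\<tau>\<close> is \<open>\<pi>\<close>, so being
        killed by \<open>\<tau>\<close> means lying in \<open>R\<close>; such an \<open>x\<close>
        represents an element of M(L) that \<open>\<sigma>\<close> sends to
        \<open>v\<close>.\<close>
      then have "x \<in> R \<inter> derived K F" using \<tau>[OF x(1)] T_subset by (auto simp: R_def)
      then show "v \<in> \<sigma> ` carrier mL" unfolding x(2) using \<sigma>[of x] by auto
    qed
  qed
  moreover have "\<tau> ` carrier mLZ = carrier LZ"
  proof -
    have "\<tau> ` carrier mLZ = \<pi> ` (T \<inter> derived K F)"
      using \<tau> by (simp add: image_image)
    \<comment> \<open>An element of \<open>L' \<inter> Z\<close> is \<open>\<pi> x\<close> for some
      \<open>x\<close> in \<open>F'\<close>, and \<open>\<pi> x \<in> Z\<close> is exactly the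
      condition that \<open>x\<close> is in \<open>T\<close>.\<close>
    also have "\<dots> = derived K L \<inter> Z"
      using subspaceD(2)[OF F.derived_subspace]
      unfolding image_derived[OF dF dL \<pi> \<pi>_surj, symmetric] by (auto simp: T_def)
    finally show ?thesis by simp
  qed
  ultimately show ?thesis
    using \<alpha>l(1,2) \<alpha>r(1,2) \<theta>l(1,2) \<theta>r(1,2) \<sigma> \<tau>
    by (intro exI[of _ \<alpha>l] exI[of _ \<theta>l] exI[of _ \<alpha>r] exI[of _ \<theta>r] exI[of _ \<sigma>] exI[of _ \<tau>]) simp
qed

end

theorem theorem4p2:
  fixes K :: "'k ring"
    and L :: "('k, 'l) dialgebra" and Z :: "'l set"
    and F :: "('k, 'f) dialgebra" and X :: "'f set" and \<pi> :: "'f \<Rightarrow> 'l"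
    and R T :: "'f set"
  assumes L: "diassociative_algebra K L"
    and fin_dim: "vectorspace.fin_dim K L"
    and Z: "central_ideal K L Z"
    and F: "free_diassociative TYPE('c) K F X"
    and \<pi>: "\<pi> \<in> dialg_hom K F L" "\<pi> ` carrier F = carrier L"
    and R: "R = {x \<in> carrier F. \<pi> x = \<zero>\<^bsub>L\<^esub>}"
    and T: "T = {x \<in> carrier F. \<pi> x \<in> Z}"
  shows "is_multiplier TYPE('c) K L (hopf_quotient K F R)
    \<and> is_multiplier TYPE('c) K (quot_dialgebra L Z) (hopf_quotient K F T)
    \<and> (let ab = quot_space L (derived K L);
           Zs = L\<lparr>carrier := Z\<rparr>;
           ML = hopf_quotient K F R;
           MLZ = hopf_quotient K F T;
           LZ = L\<lparr>carrier := derived K L \<inter> Z\<rparr>;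
           abZ = tensor_space K ab Zs;
           Zab = tensor_space K Zs ab;
           D = direct_sum (direct_sum abZ Zab) (direct_sum abZ Zab)
       in \<exists>\<alpha>l \<theta>l \<alpha>r \<theta>r \<sigma> \<tau>.
         linear_map K abZ ML \<alpha>l \<and> linear_map K Zab ML \<theta>l \<and>
         linear_map K abZ ML \<alpha>r \<and> linear_map K Zab ML \<theta>r \<and>
         (\<forall>f\<in>carrier F. \<forall>t\<in>T.
            \<alpha>l (pure_tensor K ab Zs (derived K L +>\<^bsub>L\<^esub> \<pi> f) (\<pi> t)) = hopf_denom K F R +>\<^bsub>F\<^esub> (f \<stileturn>\<^bsub>F\<^esub> t) \<and>
            \<theta>l (pure_tensor K Zs ab (\<pi> t) (derived K L +>\<^bsub>L\<^esub> \<pi> f)) = hopf_denom K F R +>\<^bsub>F\<^esub> (t \<stileturn>\<^bsub>F\<^esub> f) \<and>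
            \<alpha>r (pure_tensor K ab Zs (derived K L +>\<^bsub>L\<^esub> \<pi> f) (\<pi> t)) = hopf_denom K F R +>\<^bsub>F\<^esub> (f \<turnstile>\<^bsub>F\<^esub> t) \<and>
            \<theta>r (pure_tensor K Zs ab (\<pi> t) (derived K L +>\<^bsub>L\<^esub> \<pi> f)) = hopf_denom K F R +>\<^bsub>F\<^esub> (t \<turnstile>\<^bsub>F\<^esub> f)) \<and>
         (\<forall>x\<in>R \<inter> derived K F. \<sigma> (hopf_denom K F R +>\<^bsub>F\<^esub> x) = hopf_denom K F T +>\<^bsub>F\<^esub> x) \<and>
         (\<forall>x\<in>T \<inter> derived K F. \<tau> (hopf_denom K F T +>\<^bsub>F\<^esub> x) = \<pi> x) \<and>
         exact_at K D (\<lambda>((a, b), (c, d)). \<alpha>l a \<oplus>\<^bsub>ML\<^esub> \<theta>l b \<oplus>\<^bsub>ML\<^esub> \<alpha>r c \<oplus>\<^bsub>ML\<^esub> \<theta>r d) ML \<sigma> MLZ \<and>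
         exact_at K ML \<sigma> MLZ \<tau> LZ \<and>
         \<tau> ` carrier MLZ = carrier LZ)"
proof -
  have dF: "diassociative_algebra K F" using F by (simp add: free_diassociative_def)
  interpret G: central_ideal_presentation K L F Z \<pi>
    using L dF Z \<pi> by (intro central_ideal_presentation.intro central_ideal_presentation_axioms.intro)
  have RT: "R = G.R" "T = G.T" using R T by (simp_all add: G.R_def G.T_def)
  let ?Q = "quot_dialgebra L Z" and ?q = "\<lambda>x. Z +>\<^bsub>L\<^esub> x"
  have Q: "diassociative_algebra K ?Q" by (rule quot_dialgebra[OF L G.ideal_Z])
  have q: "?q \<in> dialg_hom K L ?Q" by (rule coset_dialg_hom[OF L G.ideal_Z])
  \<comment> \<open>The Hopf formula is applied a second time, to \<open>L/Z\<close>: the composite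
    of \<open>\<pi>\<close> with the coset map is a surjection from the same \<open>F\<close> with
    kernel \<open>T\<close>, and \<open>L/Z\<close> is finite-dimensional as an image of
    \<open>L\<close>.\<close>
  have "vectorspace.fin_dim K ?Q"
    by (rule linear_map_dim(1)[OF dialg_hom_linear[OF q L Q] _ fin_dim]) simp
  moreover have "(\<lambda>x. ?q (\<pi> x)) \<in> dialg_hom K F ?Q" by (rule dialg_hom_compose[OF \<pi>(1) q])
  moreover have "(\<lambda>x. ?q (\<pi> x)) ` carrier F = carrier ?Q"
    by (simp add: \<pi>(2)[symmetric] image_image)
  moreover have "T = {x \<in> carrier F. ?q (\<pi> x) = \<zero>\<^bsub>?Q\<^esub>}"
    unfolding T by (rule Collect_cong) (simp add: coset_eq_zero_iff[OF G.subspace_Z G.\<pi>_mem] cong: conj_cong)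
  ultimately have "is_multiplier TYPE('c) K ?Q (hopf_quotient K F T)"
    using hopf_formula[OF Q _ F] by blast
  then show ?thesis
    unfolding Let_def
    by (intro conjI hopf_formula[OF L fin_dim F \<pi> R]) (use G.ganea_exact in \<open>simp_all only: RT\<close>)
qed

end
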